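(* Let $V$ be a vector space over $\mathbb{K}$ of finite positive dimension, let $U_0,\ldots,U_d$ be a decomposition of $V$, let $K:V\to V$ be the linear map acting on $U_i$ as $q^{2i-d}$ times the identity ($0\le i\le d$), and let $R,L:V\to V$ be linear maps such that: (a) $RU_i\subseteq U_{i+1}$ for $0\le i\le d-1$ and $RU_d=0$; (b) $LU_i\subseteq U_{i-1}$ for $1\le i\le d$ and $LU_0=0$; (c) for every integer $0\le i\le d/2$ the restriction $R^{d-2i}|_{U_i}:U_i\to U_{d-i}$ is a bijection; (d) for every integer $0\le i\le d/2$ the restriction $L^{d-2i}|_{U_{d-i}}:U_{d-i}\to U_i$ is a bijection; (e) $R^3L-[3]R^2LR+[3]RLR^2-LR^3=0$; (f) $L^3R-[3]L^2RL+[3]LRL^2-RL^3=0$. Then there exists a unique $U_q(\widehat{\mathfrak{sl}}_2)$-module structure on $V$ such that $(R-e_1^-)V=0$, $(L-e_0^-)V=0$, $(K-K_0)V=0$ and $(K^{-1}-K_1)V=0$, where $e_1^-,e_0^-,K_0,K_1$ are Chevalley generators of $U_q(\widehat{\mathfrak{sl}}_2)$.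
   Context: $\mathbb{K}$ is an algebraically closed field and $q\in\mathbb{K}$ is a fixed nonzero scalar that is not a root of unity. Write $[n]=\frac{q^n-q^{-n}}{q-q^{-1}}$ for $n=0,1,\ldots$. A decomposition of a vector space $V$ over $\mathbb{K}$ of finite positive dimension is a sequence $U_0,\ldots,U_d$ of nonzero subspaces of $V$ whose sum is direct and equals $V$. The quantum affine algebra $U_q(\widehat{\mathfrak{sl}}_2)$ is the unital associative $\mathbb{K}$-algebra with generators (the Chevalley generators) $e_i^{\pm}$, $K_i^{\pm1}$, $i\in\{0,1\}$, and relations: $K_iK_i^{-1}=K_i^{-1}K_i=1$; $K_0K_1=K_1K_0$; $K_ie_i^{\pm}K_i^{-1}=q^{\pm2}e_i^{\pm}$; $K_ie_j^{\pm}K_i^{-1}=q^{\mp2}e_j^{\pm}$ for $i\ne j$; $e_i^+e_i^--e_i^-e_i^+=\frac{K_i-K_i^{-1}}{q-q^{-1}}$; $e_0^{\pm}e_1^{\mp}=e_1^{\mp}e_0^{\pm}$; and $(e_i^{\pm})^3e_j^{\pm}-[3](e_i^{\pm})^2e_j^{\pm}e_i^{\pm}+[3]e_i^{\pm}e_j^{\pm}(e_i^{\pm})^2-e_j^{\pm}(e_i^{\pm})^3=0$ for $i\neq j$. *)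

theory Defs
  imports
    "HOL-Library.Poly_Mapping"
    "HOL-Computational_Algebra.Polynomial"
    "HOL-Algebra.QuotRing"
begin

subsection \<open>Free algebras\<close>

text \<open>The monoid of words over an alphabet, written additively so that finitely supported
  functions on it carry the convolution product of \<^theory>\<open>HOL-Library.Poly_Mapping\<close>. Thus
  \<open>'a free_word \<Rightarrow>\<^sub>0 'k\<close> is the free unital associative \<open>'k\<close>-algebra on \<open>'a\<close>.\<close>

datatype 'a free_word = FWord (letters: "'a list")

instantiation free_word :: (type) monoid_add
begin

definition zero_free_word :: "'a free_word" where
  "0 = FWord []"

definition plus_free_word :: "'a free_word \<Rightarrow> 'a free_word \<Rightarrow> 'a free_word" where
  "u + v = FWord (letters u @ letters v)"

instance
  by standard (simp_all add: zero_free_word_def plus_free_word_def)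

end

definition free_gen :: "'a \<Rightarrow> 'a free_word \<Rightarrow>\<^sub>0 'k::field" where
  "free_gen x = Poly_Mapping.single (FWord [x]) 1"

definition free_scalar :: "'k::field \<Rightarrow> 'a free_word \<Rightarrow>\<^sub>0 'k" where
  "free_scalar c = Poly_Mapping.single 0 c"

definition free_algebra :: "('a free_word \<Rightarrow>\<^sub>0 'k::field) ring" where
  "free_algebra = \<lparr>carrier = UNIV, mult = (*), one = 1, zero = 0, add = (+)\<rparr>"

lemma ring_free_algebra: "ring (free_algebra :: ('a free_word \<Rightarrow>\<^sub>0 'k::field) ring)"
proof (rule ringI)
  show "abelian_group (free_algebra :: ('a free_word \<Rightarrow>\<^sub>0 'k) ring)"
  proof (rule abelian_groupI)
    fix x :: "'a free_word \<Rightarrow>\<^sub>0 'k"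
    show "\<exists>y\<in>carrier free_algebra. y \<oplus>\<^bsub>free_algebra\<^esub> x = \<zero>\<^bsub>free_algebra\<^esub>"
      by (rule bexI[of _ "- x"]) (simp_all add: free_algebra_def)
  qed (simp_all add: free_algebra_def ac_simps)
  show "Group.monoid (free_algebra :: ('a free_word \<Rightarrow>\<^sub>0 'k) ring)"
    by (rule monoidI) (simp_all add: free_algebra_def mult.assoc)
qed (simp_all add: free_algebra_def distrib_left distrib_right)


subsection \<open>The quantum affine algebra\<close>

definition qint :: "'k::field \<Rightarrow> nat \<Rightarrow> 'k" where
  "qint q n = (q powi int n - q powi (- int n)) / (q - inverse q)"

datatype node = N0 | N1

datatype sign = Pos | Neg

fun sign_int :: "sign \<Rightarrow> int" where
  "sign_int Pos = 1"
| "sign_int Neg = -1"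

text \<open>\<open>E Pos i\<close>, \<open>E Neg i\<close>, \<open>K i\<close>, \<open>Kinv i\<close> stand for \<open>e\<^sub>i\<^sup>+\<close>, \<open>e\<^sub>i\<^sup>-\<close>,
  \<open>K\<^sub>i\<close>, \<open>K\<^sub>i\<^sup>-\<^sup>1\<close>.\<close>

datatype chevalley = E sign node | K node | Kinv node

text \<open>A relation \<open>a = b\<close> is recorded as the element \<open>a - b\<close> of the free algebra.\<close>

definition uq_relators :: "'k::field \<Rightarrow> (chevalley free_word \<Rightarrow>\<^sub>0 'k) set" where
  "uq_relators q =
    (let e = (\<lambda>s i. free_gen (E s i)); k = (\<lambda>i. free_gen (K i)); k' = (\<lambda>i. free_gen (Kinv i))
     in {k i * k' i - 1 | i. True}
      \<union> {k' i * k i - 1 | i. True}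
      \<union> {k N0 * k N1 - k N1 * k N0}
      \<union> {k i * e s i * k' i - free_scalar (q powi (2 * sign_int s)) * e s i | i s. True}
      \<union> {k i * e s j * k' i - free_scalar (q powi (- 2 * sign_int s)) * e s j | i j s. i \<noteq> j}
      \<union> {e Pos i * e Neg i - e Neg i * e Pos i
           - free_scalar (1 / (q - inverse q)) * (k i - k' i) | i. True}
      \<union> {e s N0 * e t N1 - e t N1 * e s N0 | s t. s \<noteq> t}
      \<union> {e s i ^ 3 * e s j
           - free_scalar (qint q 3) * (e s i ^ 2 * e s j * e s i)
           + free_scalar (qint q 3) * (e s i * e s j * e s i ^ 2)
           - e s j * e s i ^ 3 | i j s. i \<noteq> j})"

text \<open>\<open>Idl\<close> is the two-sided ideal generated by a set.\<close>

definition uq_ideal :: "'k::field \<Rightarrow> (chevalley free_word \<Rightarrow>\<^sub>0 'k) set" where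
  "uq_ideal q = Idl\<^bsub>free_algebra\<^esub> (uq_relators q)"

definition uq :: "'k::field \<Rightarrow> (chevalley free_word \<Rightarrow>\<^sub>0 'k) set ring" where
  "uq q = free_algebra Quot (uq_ideal q)"

definition uq_class ::
  "'k::field \<Rightarrow> (chevalley free_word \<Rightarrow>\<^sub>0 'k) \<Rightarrow> (chevalley free_word \<Rightarrow>\<^sub>0 'k) set" where
  "uq_class q a = uq_ideal q +>\<^bsub>free_algebra\<^esub> a"

definition uq_gen :: "'k::field \<Rightarrow> chevalley \<Rightarrow> (chevalley free_word \<Rightarrow>\<^sub>0 'k) set" where
  "uq_gen q x = uq_class q (free_gen x)"

definition uq_scalar :: "'k::field \<Rightarrow> 'k \<Rightarrow> (chevalley free_word \<Rightarrow>\<^sub>0 'k) set" where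
  "uq_scalar q c = uq_class q (free_scalar c)"

lemma ideal_uq_ideal: "ideal (uq_ideal q) free_algebra"
  unfolding uq_ideal_def
  by (rule ring.genideal_ideal[OF ring_free_algebra]) (simp add: free_algebra_def)

lemma ring_uq: "ring (uq q)"
  unfolding uq_def by (rule ideal.quotient_is_ring[OF ideal_uq_ideal])


subsection \<open>Modules and decompositions\<close>

text \<open>\<open>act\<close> is a left module structure, over the \<open>'k\<close>-algebra \<open>A\<close> with unit map \<open>\<iota>\<close>, on the
  vector space given by \<open>scale\<close>; it extends the given vector space structure. Being
  extensional makes \<open>act\<close> determined by its values on the carrier of \<open>A\<close>.\<close>

definition algebra_module_structure ::
  "('a, 'm) ring_scheme \<Rightarrow> ('k::field \<Rightarrow> 'a) \<Rightarrow> ('k \<Rightarrow> 'v::ab_group_add \<Rightarrow> 'v)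
    \<Rightarrow> ('a \<Rightarrow> 'v \<Rightarrow> 'v) \<Rightarrow> bool" where
  "algebra_module_structure A \<iota> scale act \<longleftrightarrow>
     act \<in> extensional (carrier A) \<and>
     (\<forall>a\<in>carrier A. Vector_Spaces.linear scale scale (act a)) \<and>
     (\<forall>a\<in>carrier A. \<forall>b\<in>carrier A. \<forall>v. act (a \<oplus>\<^bsub>A\<^esub> b) v = act a v + act b v) \<and>
     (\<forall>a\<in>carrier A. \<forall>b\<in>carrier A. \<forall>v. act (a \<otimes>\<^bsub>A\<^esub> b) v = act a (act b v)) \<and>
     (\<forall>v. act \<one>\<^bsub>A\<^esub> v = v) \<and>
     (\<forall>c v. act (\<iota> c) v = scale c v)"

abbreviation uq_module_structure ::
  "'k::field \<Rightarrow> ('k \<Rightarrow> 'v::ab_group_add \<Rightarrow> 'v)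
    \<Rightarrow> ((chevalley free_word \<Rightarrow>\<^sub>0 'k) set \<Rightarrow> 'v \<Rightarrow> 'v) \<Rightarrow> bool" where
  "uq_module_structure q \<equiv> algebra_module_structure (uq q) (uq_scalar q)"

definition decomposition ::
  "('k::field \<Rightarrow> 'v::ab_group_add \<Rightarrow> 'v) \<Rightarrow> nat \<Rightarrow> (nat \<Rightarrow> 'v set) \<Rightarrow> bool" where
  "decomposition scale d U \<longleftrightarrow>
     (\<forall>i\<le>d. module.subspace scale (U i) \<and> U i \<noteq> {0}) \<and>
     (\<forall>v. \<exists>!u. u \<in> (\<Pi>\<^sub>E i\<in>{..d}. U i) \<and> v = (\<Sum>i\<le>d. u i))"

end

theory Submission
  imports Defs
begin

text \<open>
  A module structure on \<open>V\<close> is a choice of endomorphisms for the Chevalley generators that satisfies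
  the defining relations. The hypotheses prescribe \<open>e\<^sub>1\<^sup>- = R\<close>, \<open>e\<^sub>0\<^sup>- = L\<close>, \<open>K\<^sub>0 = K\<close>,
  \<open>K\<^sub>1 = K\<^sup>-\<^sup>1\<close>, and the inverses \<open>K\<^sub>i\<^sup>-\<^sup>1\<close> are then forced. It remains to see that exactly one pair
  \<open>e\<^sub>0\<^sup>+\<close>, \<open>e\<^sub>1\<^sup>+\<close> completes the picture. Exchanging \<open>(R, K, U\<^sub>i)\<close> with \<open>(L, K\<^sup>-\<^sup>1, U\<^sub>d\<^sub>-\<^sub>i)\<close> swaps the two
  nodes, so every step below serves both.

  \<^item> \<^emph>\<open>Existence of \<open>e = e\<^sub>1\<^sup>+\<close>.\<close> That \<open>R\<^sup>d\<^sup>-\<^sup>2\<^sup>i\<close> maps \<open>U\<^sub>i\<close> bijectively onto \<open>U\<^sub>d\<^sub>-\<^sub>i\<close> is the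
    Lefschetz property of a lowering operator of \<open>U\<^sub>q(sl\<^sub>2)\<close>. It yields a partial inverse of \<open>R\<close>, from
    which an \<open>e\<close> with \<open>e R - R e = [d - 2i]\<close> on \<open>U\<^sub>i\<close> is found by recursion on \<open>i\<close>
    (\<open>ex_raising_operator\<close>).

  \<^item> \<^emph>\<open>The adjoint module.\<close> Once \<open>e\<close> is there, \<open>End(V)\<close> is a \<open>U\<^sub>q(sl\<^sub>2)\<close>-module under the adjoint action
    (\<open>ad_commutator\<close>), and its weights are bounded because \<open>K\<close> has finitely many eigenvalues and \<open>q\<close>
    is not a root of unity. In any weight module with weights bounded above, the \<open>n\<close>-th power of the
    lowering operator is injective on vectors of weight \<open>n > 0\<close> (\<open>lowering_injective\<close>). This one
    fact does everything else. Two candidates for \<open>e\<close> differ by an endomorphism of weight \<open>2\<close> that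
    commutes with \<open>R\<close>, which is therefore zero (\<open>raising_unique\<close>). The cubic relation between \<open>R\<close>
    and \<open>L\<close> says that a twist of \<open>L\<close>, of weight \<open>2\<close>, is killed by the third power of the lowering
    operator; then it is a highest weight vector, that is, \<open>e\<close> commutes with \<open>L\<close>
    (\<open>commute_if_serre\<close>). By symmetry \<open>e\<^sub>0\<^sup>+\<close> commutes with \<open>R\<close>, so it is a lowest weight vector of
    weight \<open>-2\<close>, generates a module of dimension at most \<open>3\<close>, and is killed by the cube of the
    raising operator; this is the cubic relation between \<open>e\<^sub>1\<^sup>+\<close> and \<open>e\<^sub>0\<^sup>+\<close> (\<open>serre_if_commute\<close>).

  \<^item> \<^emph>\<open>Presentations.\<close> The free algebra is evaluated in the ring of additive endomorphisms of \<open>V\<close>;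
    this ring does not depend on the scalar multiplication, so it can be a type, and the linear maps
    are the elements that commute with all homotheties. An evaluation that kills the relators
    descends to the quotient, and every module arises in this way
    (\<open>ex_uq_module_of_evaluation\<close>, \<open>evaluation_of_uq_module\<close>).
\<close>

section \<open>Quantum integers\<close>

text \<open>Weights are integers of either sign, so the quantum integers are needed for all of them.\<close>

definition qi :: "'k::field \<Rightarrow> int \<Rightarrow> 'k" where
  "qi q n = (q powi n - q powi (- n)) / (q - inverse q)"

lemma qint_eq_qi: "qint q n = qi q (int n)"
  by (simp add: qint_def qi_def)

locale generic_parameter =
  fixes q :: "'k::field"
  assumes q_nonzero: "q \<noteq> 0"
    and q_not_root_of_unity: "n > 0 \<Longrightarrow> q ^ n \<noteq> 1"
begin

lemma powi_eq_1_iff: "q powi n = 1 \<longleftrightarrow> n = 0"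
proof
  assume *: "q powi n = 1"
  have "q ^ nat \<bar>n\<bar> = 1"
    using * by (cases "n \<ge> 0") (auto simp: power_int_def power_inverse)
  then show "n = 0"
    using q_not_root_of_unity[of "nat \<bar>n\<bar>"] by auto
qed simp

lemma powi_eq_iff: "q powi m = q powi n \<longleftrightarrow> m = n"
  using powi_eq_1_iff[of "m - n"] q_nonzero by (simp add: power_int_diff)

lemma qdiff_nonzero: "q - inverse q \<noteq> 0"
  using powi_eq_iff[of 1 "-1"] by simp

lemma qi_0 [simp]: "qi q 0 = 0"
  by (simp add: qi_def)

lemma qi_1 [simp]: "qi q 1 = 1"
  using qdiff_nonzero by (simp add: qi_def)

lemma qi_minus: "qi q (- n) = - qi q n"
  by (simp add: qi_def minus_divide_left)

lemma qi_eq_0_iff: "qi q n = 0 \<longleftrightarrow> n = 0"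
  using qdiff_nonzero powi_eq_iff[of n "-n"] by (simp add: qi_def)

lemma qi_3: "qi q 3 = q powi 2 + 1 + q powi (-2)"
proof -
  have "q powi 3 - q powi (-3) = (q powi 2 + 1 + q powi (-2)) * (q - inverse q)"
    using q_nonzero by (simp add: power_int_minus field_simps) (simp add: eval_nat_numeral algebra_simps)
  then show ?thesis
    using qdiff_nonzero by (simp add: qi_def)
qed

text \<open>The sum arises when a raising operator is moved past \<open>m\<close> lowering operators, each of which
  contributes the weight that it finds. The product form shows when it vanishes.\<close>

lemma sum_qi: "(\<Sum>t<m. qi q (n - 2 * int t)) = qi q (int m) * qi q (n - int m + 1)"
proof (induction m)
  case (Suc m)
  \<comment> \<open>In terms of \<open>A = q\<^sup>m\<close> and \<open>B = q\<^sup>n\<close> the induction step is an identity of rational functions.\<close>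
  define A where "A = q powi (int m)"
  define B where "B = q powi n"
  have nz: "A \<noteq> 0" "B \<noteq> 0" using q_nonzero by (auto simp: A_def B_def)
  define D where "D = q - inverse q"
  have D: "D \<noteq> 0" using qdiff_nonzero by (simp add: D_def)
  have num: "(A - inverse A) * (B * q / A - A / (B * q)) + (B / A\<^sup>2 - A\<^sup>2 / B) * D
     = (A * q - inverse (A * q)) * (B / A - A / B)"
    using nz q_nonzero unfolding D_def by (simp add: field_simps power2_eq_square)
  have p: "q powi (int (Suc m)) = A * q" "q powi (- int (Suc m)) = inverse (A * q)"
     "q powi (- int m) = inverse A"
     "q powi (n - int m + 1) = B * q / A" "q powi (- (n - int m + 1)) = A / (B * q)"
     "q powi (n - 2 * int m) = B / A\<^sup>2" "q powi (- (n - 2 * int m)) = A\<^sup>2 / B"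
     "q powi (n - int (Suc m) + 1) = B / A" "q powi (- (n - int (Suc m) + 1)) = A / B"
    using q_nonzero
    by (simp_all add: A_def B_def power_int_add power_int_diff power_int_minus power_int_mult
        field_simps power2_eq_square)
  have "(\<Sum>t<Suc m. qi q (n - 2 * int t))
     = ((A - inverse A) * (B * q / A - A / (B * q)) + (B / A\<^sup>2 - A\<^sup>2 / B) * D) / (D * D)"
    unfolding sum.lessThan_Suc Suc.IH unfolding qi_def p A_def[symmetric] D_def[symmetric]
    using D by (simp add: field_simps)
  also have "\<dots> = qi q (int (Suc m)) * qi q (n - int (Suc m) + 1)"
    by (simp only: num qi_def p D_def[symmetric]) simp
  finally show ?case .
qed simp

end

section \<open>Weight modules of \<open>U\<^sub>q(sl\<^sub>2)\<close>\<close>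

text \<open>Only the relation between the raising operator \<open>X\<close> and the lowering operator \<open>Y\<close> is kept of a
  \<open>U\<^sub>q(sl\<^sub>2)\<close>-module; the Cartan element enters through the weight sets \<open>W n\<close>.\<close>

locale sl2_weight_module = vector_space sc + generic_parameter q
  for sc :: "'k::field \<Rightarrow> 'w::ab_group_add \<Rightarrow> 'w" and q :: 'k +
  fixes X Y :: "'w \<Rightarrow> 'w" and W :: "int \<Rightarrow> 'w set" and N :: int
  assumes X_0: "X 0 = 0"
    and Y_0: "Y 0 = 0"
    and Y_add: "Y (u + v) = Y u + Y v"
    and Y_scale: "Y (sc c v) = sc c (Y v)"
    and X_weight: "v \<in> W n \<Longrightarrow> X v \<in> W (n + 2)"
    and Y_weight: "v \<in> W n \<Longrightarrow> Y v \<in> W (n - 2)"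
    and commutator: "v \<in> W n \<Longrightarrow> X (Y v) = Y (X v) + sc (qi q n) v"
    and bounded: "v \<in> W n \<Longrightarrow> n > N \<Longrightarrow> v = 0"
begin

lemma Y_pow_weight: "v \<in> W n \<Longrightarrow> (Y ^^ m) v \<in> W (n - 2 * int m)"
  by (induction m) (auto dest: Y_weight simp: algebra_simps)

lemma Y_pow_0 [simp]: "(Y ^^ m) 0 = 0"
  by (induction m) (auto simp: Y_0)

lemma X_Y_pow:
  assumes "v \<in> W n"
  shows "X ((Y ^^ Suc m) v) = (Y ^^ Suc m) (X v)
     + sc (qi q (int (Suc m)) * qi q (n - int m)) ((Y ^^ m) v)"
proof -
  have "X ((Y ^^ Suc m) v) = (Y ^^ Suc m) (X v) + sc (\<Sum>t<Suc m. qi q (n - 2 * int t)) ((Y ^^ m) v)"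
  proof (induction m)
    case 0
    then show ?case using commutator[OF assms] by simp
  next
    case (Suc m)
    have "X ((Y ^^ Suc (Suc m)) v) = Y (X ((Y ^^ Suc m) v))
       + sc (qi q (n - 2 * int (Suc m))) ((Y ^^ Suc m) v)"
      using commutator[OF Y_pow_weight[OF assms, of "Suc m"]] by simp
    also have "\<dots> = (Y ^^ Suc (Suc m)) (X v)
       + (sc (\<Sum>t<Suc m. qi q (n - 2 * int t)) ((Y ^^ Suc m) v)
       + sc (qi q (n - 2 * int (Suc m))) ((Y ^^ Suc m) v))"
      unfolding Suc.IH by (simp add: Y_add Y_scale add.assoc)
    finally show ?case
      by (simp add: scale_left_distrib add.assoc)
  qed
  then show ?thesis
    unfolding sum_qi by simp
qed

text \<open>Since weights are bounded above, one may assume the claim for \<open>X v\<close>, whose weight is \<open>n + 2\<close>.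
  Moving \<open>X\<close> to the left shows that \<open>Y\<^sup>n\<^sup>+\<^sup>2\<close> kills \<open>X v\<close>, hence \<open>X v = 0\<close>: the vector \<open>v\<close> is a highest
  weight vector, and on such a vector \<open>X\<close> undoes \<open>Y\<close> up to nonzero scalars for \<open>n\<close> steps.\<close>

lemma lowering_injective:
  assumes "v \<in> W (int n)" "n > 0" "(Y ^^ n) v = 0"
  shows "v = 0"
  using assms
proof (induction "nat (N - int n + 1)" arbitrary: n v rule: less_induct)
  case less
  show ?case
  proof (cases "int n > N")
    case True
    then show ?thesis using bounded less.prems by blast
  next
    case False
    have Xv: "X v \<in> W (int (n + 2))"
      using X_weight[OF less.prems(1)] by (simp add: add.commute)
    have "(Y ^^ m) v = 0" if "m \<ge> n" for m
      using less.prems(3) that by (metis Y_pow_0 comp_apply funpow_add le_add_diff_inverse2)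
    then have "(Y ^^ (n + 2)) (X v) = 0"
      using X_Y_pow[OF less.prems(1), of "Suc n"] by (simp add: X_0 del: funpow.simps)
    then have Xv0: "X v = 0"
      using less.hyps[OF _ Xv] False by simp
    \<comment> \<open>Now \<open>X Y\<^sup>m\<^sup>+\<^sup>1 v = [m + 1] [n - m] Y\<^sup>m v\<close>, so vanishing descends from \<open>Y\<^sup>n v\<close> to \<open>v\<close>.\<close>
    have "(Y ^^ (n - j)) v = 0" if "j \<le> n" for j
      using that
    proof (induction j)
      case 0
      then show ?case using less.prems by simp
    next
      case (Suc j)
      define m where "m = n - Suc j"
      have m: "n - j = Suc m" using Suc.prems by (simp add: m_def)
      have "sc (qi q (int (Suc m)) * qi q (int n - int m)) ((Y ^^ m) v) = 0"
        using X_Y_pow[OF less.prems(1), of m] Suc by (simp add: m Xv0 X_0 del: funpow.simps)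
      moreover have "m < n" using Suc.prems by (simp add: m_def)
      ultimately show ?case
        by (simp add: qi_eq_0_iff m_def)
    qed
    from this[of n] show ?thesis by simp
  qed
qed

text \<open>The string below a vector of weight \<open>n\<close> stops after \<open>n + 1\<close> steps only if there is nothing above
  it: \<open>X v\<close> has weight \<open>n + 2\<close> and is killed by \<open>Y\<^sup>n\<^sup>+\<^sup>2\<close>.\<close>

lemma highest_weight_if_lowering_power:
  assumes v: "v \<in> W (int n)" and 0: "(Y ^^ (n + 1)) v = 0"
  shows "X v = 0"
proof (rule lowering_injective[of _ "n + 2"])
  show "X v \<in> W (int (n + 2))"
    using X_weight[OF v] by (simp add: add.commute)
  have "(Y ^^ Suc (Suc n)) v = 0"
    using 0 by (simp add: Y_0)
  then show "(Y ^^ (n + 2)) (X v) = 0"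
    using X_Y_pow[OF v, of "Suc n"] 0 by (simp add: X_0 del: funpow.simps)
qed simp

end

section \<open>The adjoint action on an algebra containing a quantum \<open>sl\<^sub>2\<close>\<close>

definition serre :: "'a::{ring,monoid_mult} \<Rightarrow> 'a \<Rightarrow> 'a \<Rightarrow> 'a" where
  "serre c x y = x ^ 3 * y - c * (x ^ 2 * y * x) + c * (x * y * x ^ 2) - y * x ^ 3"

text \<open>A ring with a homomorphism from a field whose image need not be central; the algebra is the
  centralizer of that image. In the application the ring consists of the additive endomorphisms of a
  vector space, and the centralizer of the linear ones.\<close>

locale scalar_ring =
  fixes s :: "'k::field \<Rightarrow> 'a::{ring,monoid_mult}"
  assumes s_add: "s (a + b) = s a + s b"
    and s_mult: "s (a * b) = s a * s b"
    and s_1: "s 1 = 1"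
begin

lemma s_0: "s 0 = 0"
  using s_add[of 0 0] by simp

lemma s_minus: "s (- a) = - s a"
  using s_add[of a "- a"] by (simp add: s_0 add_eq_0_iff)

lemma s_diff: "s (a - b) = s a - s b"
  using s_add[of a "- b"] by (simp add: s_minus)

lemma s_commute: "s a * s b = s b * s a"
  by (simp add: s_mult[symmetric] mult.commute)

definition centralizer :: "'a set" where
  "centralizer = {y. \<forall>c. s c * y = y * s c}"

lemma centralizer_simps:
  assumes "y \<in> centralizer"
  shows "y * s c = s c * y" "y * (s c * z) = s c * (y * z)"
  using assms by (simp_all add: centralizer_def mult.assoc[symmetric])

lemma centralizer_closed:
  "1 \<in> centralizer" "0 \<in> centralizer" "s c \<in> centralizer"
  "x \<in> centralizer \<Longrightarrow> y \<in> centralizer \<Longrightarrow> x * y \<in> centralizer"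
  "x \<in> centralizer \<Longrightarrow> y \<in> centralizer \<Longrightarrow> x + y \<in> centralizer"
  "x \<in> centralizer \<Longrightarrow> y \<in> centralizer \<Longrightarrow> x - y \<in> centralizer"
  by (auto simp: centralizer_def s_commute distrib_left distrib_right left_diff_distrib
      right_diff_distrib) (metis mult.assoc)

end

text \<open>The elements \<open>e, f, k, k'\<close> satisfy the relations of \<open>U\<^sub>q(sl\<^sub>2)\<close>, and conjugation by \<open>k\<close> has no
  eigenvalue \<open>q\<^sup>n\<close> with \<open>n > N\<close>; in an endomorphism algebra this expresses that \<open>k\<close> is diagonalizable
  with finitely many eigenvalues, all of them powers of \<open>q\<close>.\<close>

locale quantum_sl2 = scalar_ring s + generic_parameter q
  for s :: "'k::field \<Rightarrow> 'a::{ring,monoid_mult}" and q :: 'k +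
  fixes e f k k' :: 'a and N :: int
  assumes central: "e \<in> centralizer" "f \<in> centralizer" "k \<in> centralizer" "k' \<in> centralizer"
    and k_inverse: "k * k' = 1" "k' * k = 1"
    and k_e: "k * e = s (q powi 2) * e * k"
    and k_f: "k * f = s (q powi (-2)) * f * k"
    and e_f: "e * f - f * e = s (1 / (q - inverse q)) * (k - k')"
    and weights_bounded:
      "y \<in> centralizer \<Longrightarrow> k * y = s (q powi n) * y * k \<Longrightarrow> n > N \<Longrightarrow> y = 0"
begin

definition weight :: "int \<Rightarrow> 'a set" where
  "weight n = {y \<in> centralizer. k * y = s (q powi n) * y * k}"

lemma weight_central: "y \<in> weight n \<Longrightarrow> y \<in> centralizer"
  by (simp add: weight_def)

lemma weight_k: "y \<in> weight n \<Longrightarrow> k * y = s (q powi n) * (y * k)"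
  by (simp add: weight_def mult.assoc)

lemma weight_k':
  assumes "y \<in> weight n"
  shows "k' * y = s (q powi (- n)) * (y * k')"
proof -
  have "k' * y = k' * (s (q powi (- n)) * (s (q powi n) * (y * (k * k'))))"
    using q_nonzero by (simp add: k_inverse mult.assoc[symmetric] s_mult[symmetric] s_1
        power_int_minus)
  also have "\<dots> = s (q powi (- n)) * (k' * (k * y * k'))"
    using weight_k[OF assms] by (simp add: centralizer_simps[OF central(4)] mult.assoc)
  also have "\<dots> = s (q powi (- n)) * (y * k')"
    using k_inverse(2) by (metis mult.assoc mult_1)
  finally show ?thesis .
qed

lemma weight_closed:
  "x \<in> weight n \<Longrightarrow> y \<in> weight n \<Longrightarrow> x - y \<in> weight n"
  by (simp_all add: weight_def centralizer_closed distrib_left distrib_right left_diff_distrib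
      right_diff_distrib)

lemma weight_mult:
  assumes "x \<in> weight m" "y \<in> weight n"
  shows "x * y \<in> weight (m + n)"
proof -
  note c = centralizer_simps[OF weight_central[OF assms(1)]]
  have "k * (x * y) = s (q powi m) * (x * (k * y))"
    using weight_k[OF assms(1)] by (metis mult.assoc)
  also have "\<dots> = s (q powi m) * (s (q powi n) * (x * (y * k)))"
    by (simp add: weight_k[OF assms(2)] c)
  also have "\<dots> = s (q powi (m + n)) * (x * y) * k"
    using q_nonzero by (simp add: power_int_add s_mult mult.assoc)
  finally show ?thesis
    using assms by (simp add: weight_def centralizer_closed)
qed

lemma generator_weights: "e \<in> weight 2" "f \<in> weight (-2)" "k \<in> weight 0" "k' \<in> weight 0"
  by (simp_all add: weight_def central k_e k_f k_inverse s_1)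

text \<open>These are the operators \<open>y \<mapsto> \<Sum> x\<^sub>1 y S(x\<^sub>2)\<close> for \<open>x = e, f\<close>, with the coproduct
  \<open>\<Delta>(e) = e \<otimes> 1 + k \<otimes> e\<close>, \<open>\<Delta>(f) = f \<otimes> k\<^sup>-\<^sup>1 + 1 \<otimes> f\<close> and antipode \<open>S(e) = - k\<^sup>-\<^sup>1 e\<close>, \<open>S(f) = - f k\<close>.
  With this choice an element is killed by \<open>ad_f\<close> precisely if it commutes with \<open>f\<close>.\<close>

definition ad_e :: "'a \<Rightarrow> 'a" where
  "ad_e y = e * y - k * y * k' * e"

definition ad_f :: "'a \<Rightarrow> 'a" where
  "ad_f y = (f * y - y * f) * k"

text \<open>A direct computation: after moving \<open>k\<close> and \<open>k'\<close> to the right of \<open>e\<close> and \<open>f\<close>, all terms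
  cancel except \<open>(e f - f e) y k - k y (e f - f e)\<close>, which is
  \<open>(k y k' - k' y k) / (q - q\<^sup>-\<^sup>1)\<close>.\<close>

lemma ad_commutator:
  assumes y: "y \<in> weight n"
  shows "ad_e (ad_f y) = ad_f (ad_e y) + s (qi q n) * y"
proof -
  \<comment> \<open>With \<open>a = q\<^sup>2\<close>, \<open>b = q\<^sup>-\<^sup>2\<close> as commuting letters, the rules below bring words into normal form.\<close>
  define a b t where "a = s (q powi 2)" and "b = s (q powi (-2))"
    and "t = s (1 / (q - inverse q))"
  have ab: "a * b = 1" "b * a = 1"
    using q_nonzero by (simp_all add: a_def b_def s_mult[symmetric] s_1 power_int_minus)
  have ab': "a * (b * z) = z" "b * (a * z) = z" for z
    by (simp_all add: ab mult.assoc[symmetric])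
  have kk': "k * (k' * z) = z" "k' * (k * z) = z" for z
    by (simp_all add: k_inverse mult.assoc[symmetric])
  note wk = generator_weights(1,2)[THEN weight_k] generator_weights(1,2)[THEN weight_k']
  have ke: "k * e = a * (e * k)" "k * f = b * (f * k)"
     "k' * e = b * (e * k')" "k' * f = a * (f * k')"
    using wk by (simp_all add: a_def b_def)
  have ke': "k * (e * z) = a * (e * (k * z))" "k * (f * z) = b * (f * (k * z))"
     "k' * (e * z) = b * (e * (k' * z))" "k' * (f * z) = a * (f * (k' * z))" for z
    using ke by (simp_all only: mult.assoc[symmetric])
  have ef: "e * f = f * e + t * k - t * k'"
    using e_f by (simp add: t_def algebra_simps)
  have ef': "e * (f * z) = f * (e * z) + t * (k * z) - t * (k' * z)" for z
    unfolding mult.assoc[symmetric] ef by (simp add: algebra_simps)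
  have yc: "y \<in> centralizer" using y by (rule weight_central)
  note cs = centralizer_simps[OF central(1)] centralizer_simps[OF central(2)]
    centralizer_simps[OF central(3)] centralizer_simps[OF central(4)] centralizer_simps[OF yc]
  note cs' = cs[of "q powi 2", folded a_def] cs[of "q powi (-2)", folded b_def]
    cs[of "1 / (q - inverse q)", folded t_def]
  have "ad_e (ad_f y) - ad_f (ad_e y) = t * (k * y * k' - k' * y * k)"
    unfolding ad_e_def ad_f_def
    by (simp add: algebra_simps ke ke' kk' k_inverse ef ef' ab ab' cs')
  also have "k * y * k' = s (q powi n) * y"
    by (simp add: weight_k[OF y] mult.assoc k_inverse)
  also have "k' * y * k = s (q powi (- n)) * y"
    by (simp add: weight_k'[OF y] mult.assoc k_inverse)
  also have "t * (s (q powi n) * y - s (q powi (- n)) * y) = s (qi q n) * y"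
    by (simp add: t_def qi_def s_mult[symmetric] s_diff[symmetric] left_diff_distrib[symmetric]
        mult.assoc[symmetric])
  finally show ?thesis by (simp add: algebra_simps)
qed

sublocale adjoint: sl2_weight_module "\<lambda>c y. s c * y" q ad_e ad_f weight N
proof
  fix c u v
  show "ad_f (s c * v) = s c * ad_f v"
    by (simp add: ad_f_def centralizer_simps central mult.assoc right_diff_distrib
        left_diff_distrib)
  show "ad_f (u + v) = ad_f u + ad_f v"
    by (simp add: ad_f_def algebra_simps)
next
  fix v n
  assume v: "v \<in> weight n"
  have "e * v \<in> weight (2 + n)" "k * v * k' * e \<in> weight (0 + n + 0 + 2)"
    by (intro weight_mult generator_weights v)+
  then show "ad_e v \<in> weight (n + 2)"
    by (simp add: ad_e_def weight_closed add.commute)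
  have "f * v * k \<in> weight (-2 + n + 0)" "v * f * k \<in> weight (n + -2 + 0)"
    by (intro weight_mult generator_weights v)+
  then show "ad_f v \<in> weight (n - 2)"
    by (simp add: ad_f_def weight_closed left_diff_distrib)
  show "ad_e (ad_f v) = ad_f (ad_e v) + s (qi q n) * v"
    using ad_commutator[OF v] .
  show "v = 0" if "n > N"
    using weights_bounded v that by (auto simp: weight_def)
qed (simp_all add: ad_e_def ad_f_def s_add s_mult s_1 algebra_simps)

text \<open>An element commuting with \<open>f\<close> is a lowest weight vector of the adjoint module, and lowest
  weights are not positive.\<close>

lemma commuting_positive_weight_eq_0:
  assumes y: "y \<in> weight (int n)" "n > 0" and fy: "f * y = y * f"
  shows "y = 0"
proof (rule adjoint.lowering_injective[OF y])
  have "(ad_f ^^ Suc m) y = 0" for m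
    by (induction m) (simp_all add: ad_f_def fy)
  then show "(ad_f ^^ n) y = 0"
    using y(2) by (cases n) blast+
qed

text \<open>On elements of weight \<open>n\<close> the operator \<open>ad_e\<close> is \<open>y \<mapsto> e y - q\<^sup>n y e\<close>, so on the weights
  \<open>-2, 0, 2\<close> its cube is the cubic relation. The cube of \<open>ad_e\<close> applied to a lowest weight vector of
  weight \<open>-2\<close> is again killed by \<open>ad_f\<close> but has weight \<open>4\<close>, so it vanishes.\<close>

lemma serre_if_commute:
  assumes x: "x \<in> weight (-2)" and fx: "f * x = x * f"
  shows "serre (s (qint q 3)) e x = 0"
proof -
  define a b where "a = s (q powi 2)" and "b = s (q powi (-2))"
  have ab: "a * b = 1" "b * a = 1"
    using q_nonzero by (simp_all add: a_def b_def s_mult[symmetric] s_1 power_int_minus)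
  have ab': "a * (b * z) = z" "b * (a * z) = z" for z
    by (simp_all add: ab mult.assoc[symmetric])
  have c3: "s (qint q 3) = a + 1 + b"
    by (simp add: qint_eq_qi qi_3 a_def b_def s_add s_1)
  note cs = centralizer_simps[OF central(1)] centralizer_simps[OF weight_central[OF x]]
  note cs' = cs[of "q powi 2", folded a_def] cs[of "q powi (-2)", folded b_def]
  have ad: "ad_e y = e * y - s (q powi m) * (y * e)" if "y \<in> weight m" for y m
    using weight_k[OF that] by (simp add: ad_e_def mult.assoc)
      (metis k_inverse(1) mult.assoc mult_1)
  define x1 where "x1 = ad_e x"
  define x2 where "x2 = ad_e x1"
  define x3 where "x3 = ad_e x2"
  have x1: "x1 \<in> weight 0" "x1 = e * x - b * (x * e)"
    using adjoint.X_weight[OF x] ad[OF x] by (simp_all add: x1_def b_def)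
  have x2: "x2 \<in> weight 2" "x2 = e * x1 - x1 * e"
    using adjoint.X_weight[OF x1(1)] ad[OF x1(1)] by (simp_all add: x2_def s_1)
  have x3: "x3 \<in> weight 4" "x3 = e * x2 - a * (x2 * e)"
    using adjoint.X_weight[OF x2(1)] ad[OF x2(1)] by (simp_all add: x3_def a_def)
  have serre: "x3 = serre (s (qint q 3)) e x"
    unfolding serre_def c3 x3(2) x2(2) x1(2)
    by (simp add: algebra_simps cs' ab ab' eval_nat_numeral)
  \<comment> \<open>\<open>ad_f\<close> maps \<open>x1\<close> to \<open>[2] x\<close> and \<open>x2\<close> to \<open>[2] x1\<close>; at \<open>x3\<close> the two contributions cancel.\<close>
  have f0: "ad_f x = 0"
    by (simp add: ad_f_def fx)
  have f1: "ad_f x1 = - (s (qi q (-2)) * x)"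
    using adjoint.commutator[OF x] by (simp add: x1_def f0 adjoint.X_0 eq_neg_iff_add_eq_0)
  have f2: "ad_f x2 = ad_e (ad_f x1)"
    using adjoint.commutator[OF x1(1)] by (simp add: x2_def s_0)
  have lin: "ad_e (s c * y) = s c * ad_e y" "ad_e (- y) = - ad_e y" for c y
    by (simp_all add: ad_e_def centralizer_simps central mult.assoc right_diff_distrib)
  have "ad_f x2 = s (qi q 2) * x1"
    unfolding f2 f1 lin by (simp add: x1_def qi_minus s_minus)
  then have "ad_f x3 = 0"
    using adjoint.commutator[OF x2(1)] by (simp add: x3_def lin x2_def)
  then have "f * x3 = x3 * f"
    unfolding ad_f_def by (metis eq_iff_diff_eq_0 k_inverse(1) mult.assoc mult_1_right mult_zero_left)
  then show ?thesis
    using commuting_positive_weight_eq_0[of x3 4] x3(1) serre by simp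
qed

text \<open>The twist by \<open>k'\<close> is dictated by the asymmetry of the adjoint action: \<open>ad_e (x k')\<close> is the plain
  commutator \<open>(e x - x e) k'\<close>, whereas the cube of \<open>ad_f\<close> turns \<open>x k'\<close> into the cubic relation times
  \<open>k\<^sup>2\<close>. As \<open>x k'\<close> has weight \<open>2\<close>, being killed by the cube makes it a highest weight vector.\<close>

lemma commute_if_serre:
  assumes x: "x \<in> weight 2" and s0: "serre (s (qint q 3)) f x = 0"
  shows "e * x = x * e"
proof -
  define a b where "a = s (q powi 2)" and "b = s (q powi (-2))"
  have ab: "a * b = 1" "b * a = 1"
    using q_nonzero by (simp_all add: a_def b_def s_mult[symmetric] s_1 power_int_minus)
  have ab': "a * (b * z) = z" "b * (a * z) = z" for z
    by (simp_all add: ab mult.assoc[symmetric])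
  have c3: "s (qint q 3) = a + 1 + b"
    by (simp add: qint_eq_qi qi_3 a_def b_def s_add s_1)
  have kk': "k * (k' * z) = z" "k' * (k * z) = z" for z
    by (simp_all add: k_inverse mult.assoc[symmetric])
  note wk = generator_weights(1,2)[THEN weight_k] generator_weights(1,2)[THEN weight_k']
  have ke: "k * e = a * (e * k)" "k * f = b * (f * k)"
     "k' * e = b * (e * k')" "k' * f = a * (f * k')"
    using wk by (simp_all add: a_def b_def)
  have ke': "k * (e * z) = a * (e * (k * z))" "k * (f * z) = b * (f * (k * z))"
     "k' * (e * z) = b * (e * (k' * z))" "k' * (f * z) = a * (f * (k' * z))" for z
    using ke by (simp_all only: mult.assoc[symmetric])
  have kx: "k * x = a * (x * k)"
    using weight_k[OF x] by (simp add: a_def)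
  have kx': "k * (x * z) = a * (x * (k * z))" for z
    using kx by (simp only: mult.assoc[symmetric])
  note cs = centralizer_simps[OF central(1)] centralizer_simps[OF central(2)]
    centralizer_simps[OF central(3)] centralizer_simps[OF central(4)]
    centralizer_simps[OF weight_central[OF x]]
  note cs' = cs[of "q powi 2", folded a_def] cs[of "q powi (-2)", folded b_def]
  have "x * k' \<in> weight (2 + 0)"
    by (intro weight_mult x generator_weights)
  moreover have "(ad_f ^^ 3) (x * k') = serre (s (qint q 3)) f x * k * k"
    unfolding serre_def c3 ad_f_def
    by (simp add: eval_nat_numeral algebra_simps cs' ab ab' ke ke' kk' k_inverse)
  ultimately have "ad_e (x * k') = 0"
    using adjoint.highest_weight_if_lowering_power[of "x * k'" 2] by (simp add: s0)
  then have "(e * x - x * e) * k' = 0"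
    unfolding ad_e_def
    by (simp add: algebra_simps cs' ab ab' ke ke' kk' k_inverse kx kx')
  then have "(e * x - x * e) * (k' * k) = 0"
    by (simp add: mult.assoc[symmetric])
  then show ?thesis
    by (simp add: k_inverse)
qed

lemma raising_unique:
  assumes "e2 \<in> weight 2" "e2 * f - f * e2 = s (1 / (q - inverse q)) * (k - k')"
  shows "e2 = e"
proof -
  have "e2 - e = 0"
  proof (rule commuting_positive_weight_eq_0[of _ 2])
    show "e2 - e \<in> weight (int 2)"
      using assms generator_weights by (simp add: weight_closed)
    show "f * (e2 - e) = (e2 - e) * f"
      using assms(2)[folded e_f] by (simp add: algebra_simps)
  qed simp
  then show ?thesis by simp
qed

end

section \<open>Raising operators from the Lefschetz property\<close>

locale weight_space_decomposition = vector_space scale + generic_parameter q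
  for scale :: "'k::field \<Rightarrow> 'v::ab_group_add \<Rightarrow> 'v" and q :: 'k +
  fixes d :: nat and U :: "nat \<Rightarrow> 'v set"
  assumes decomposition: "decomposition scale d U"
begin

lemma subspace_U: "i \<le> d \<Longrightarrow> subspace (U i)"
  using decomposition by (simp add: decomposition_def)

text \<open>The component of a vector in the \<open>i\<close>-th summand.\<close>

definition pr :: "nat \<Rightarrow> 'v \<Rightarrow> 'v" where
  "pr i v = (THE u. u \<in> (\<Pi>\<^sub>E i\<in>{..d}. U i) \<and> v = (\<Sum>i\<le>d. u i)) i"

lemma pr_in: "i \<le> d \<Longrightarrow> pr i v \<in> U i"
  and sum_pr: "(\<Sum>i\<le>d. pr i v) = v"
  and pr_unique: "(\<And>i. i \<le> d \<Longrightarrow> u i \<in> U i) \<Longrightarrow> v = (\<Sum>i\<le>d. u i) \<Longrightarrow> i \<le> d \<Longrightarrow> pr i v = u i"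
proof -
  let ?P = "\<lambda>v u. u \<in> (\<Pi>\<^sub>E i\<in>{..d}. U i) \<and> v = (\<Sum>i\<le>d. u i)"
  have ex1: "\<exists>!u. ?P v u" for v
    using decomposition by (simp add: decomposition_def)
  have P: "?P v (\<lambda>i. pr i v)" for v
    using theI'[OF ex1[of v]] by (simp add: pr_def)
  show "pr i v \<in> U i" if "i \<le> d" for i v
    using P[of v] that by (auto simp: PiE_def)
  show "(\<Sum>i\<le>d. pr i v) = v" for v
    using P[of v] by simp
  show "pr i v = u i" if "\<And>i. i \<le> d \<Longrightarrow> u i \<in> U i" "v = (\<Sum>i\<le>d. u i)" "i \<le> d" for u v i
  proof -
    have "?P v (restrict u {..d})"
      using that by auto
    then have "restrict u {..d} = (\<lambda>i. pr i v)"
      using ex1[of v] P[of v] by blast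
    then show ?thesis
      using that(3) by (metis atMost_iff restrict_apply')
  qed
qed

lemma linear_pr:
  assumes "i \<le> d"
  shows "Vector_Spaces.linear scale scale (pr i)"
proof -
  have "pr i (x + y) = pr i x + pr i y" for x y
    by (rule pr_unique[OF _ _ assms, where u = "\<lambda>i. pr i x + pr i y"])
      (simp_all add: sum.distrib sum_pr subspace_add subspace_U pr_in)
  moreover have "pr i (scale c x) = scale c (pr i x)" for c x
    by (rule pr_unique[OF _ _ assms, where u = "\<lambda>i. scale c (pr i x)"])
      (simp_all add: scale_sum_right[symmetric] sum_pr subspace_scale subspace_U pr_in)
  ultimately show ?thesis
    by unfold_locales (simp_all add: algebra_simps)
qed

lemma pr_homogeneous:
  assumes "u \<in> U i" "i \<le> d" "j \<le> d"
  shows "pr j u = (if j = i then u else 0)"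
  by (rule pr_unique[OF _ _ assms(3), where u = "\<lambda>j. if j = i then u else 0"])
    (use assms in \<open>auto simp: subspace_0 subspace_U\<close>)

lemma linear_eqI:
  assumes "Vector_Spaces.linear scale scale g" "Vector_Spaces.linear scale scale h"
    and "\<And>i u. i \<le> d \<Longrightarrow> u \<in> U i \<Longrightarrow> g u = h u"
  shows "g = h"
proof
  fix v
  interpret g: Vector_Spaces.linear scale scale g by fact
  interpret h: Vector_Spaces.linear scale scale h by fact
  have "g (\<Sum>i\<le>d. pr i v) = h (\<Sum>i\<le>d. pr i v)"
    unfolding g.sum h.sum by (intro sum.cong refl assms(3)) (auto intro: pr_in)
  then show "g v = h v" by (simp add: sum_pr)
qed

lemma no_other_eigenvalue:
  assumes "Vector_Spaces.linear scale scale \<kappa>"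
    and eigen: "\<And>i u. i \<le> d \<Longrightarrow> u \<in> U i \<Longrightarrow> \<kappa> u = scale (ev i) u"
    and v: "\<kappa> v = scale c v" and c: "\<And>i. i \<le> d \<Longrightarrow> c \<noteq> ev i"
  shows "v = 0"
proof -
  interpret \<kappa>: Vector_Spaces.linear scale scale \<kappa> by fact
  have "pr i v = 0" if "i \<le> d" for i
  proof -
    interpret pr: Vector_Spaces.linear scale scale "pr i" using that by (rule linear_pr)
    have "pr i (\<kappa> v) = scale (ev i) (pr i v)"
    proof (rule pr_unique[OF _ _ that])
      show "\<kappa> v = (\<Sum>i\<le>d. scale (ev i) (pr i v))"
        by (subst sum_pr[symmetric], subst \<kappa>.sum) (auto intro!: sum.cong eigen pr_in)
    qed (simp add: subspace_scale subspace_U pr_in)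
    then have "scale (c - ev i) (pr i v) = 0"
      by (simp add: v pr.scale scale_left_diff_distrib)
    then show ?thesis using c[OF that] by simp
  qed
  then show ?thesis using sum_pr[of v] by simp
qed

end

locale lefschetz = weight_space_decomposition +
  fixes R :: "'b \<Rightarrow> 'b"
  assumes R_linear: "Vector_Spaces.linear scale scale R"
    and R_raises: "i < d \<Longrightarrow> u \<in> U i \<Longrightarrow> R u \<in> U (Suc i)"
    and R_top: "u \<in> U d \<Longrightarrow> R u = 0"
    and R_bij: "2 * i \<le> d \<Longrightarrow> bij_betw (R ^^ (d - 2 * i)) (U i) (U (d - i))"
begin

sublocale R: Vector_Spaces.linear scale scale R by (rule R_linear)

lemma linear_R_pow: "Vector_Spaces.linear scale scale (R ^^ n)"
proof (induction n)
  case 0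
  then show ?case by (simp add: id_def linear_ident)
next
  case (Suc n)
  then show ?case
    unfolding funpow.simps by (rule Vector_Spaces.linear_compose[OF _ R_linear])
qed

lemma R_pow_raises: "i + n \<le> d \<Longrightarrow> u \<in> U i \<Longrightarrow> (R ^^ n) u \<in> U (i + n)"
  by (induction n) (auto intro: R_raises)

text \<open>Below the middle \<open>R\<close> is injective on \<open>U\<^sub>i\<close>, above it is surjective onto \<open>U\<^sub>i\<^sub>+\<^sub>1\<close>; the map \<open>W\<^sub>i\<close> is a
  left inverse in the first case and a right inverse in the second. A left inverse is determined by its
  kernel, which is taken to be the space of primitive vectors: those that the power of \<open>R\<close> just
  beyond the Lefschetz bijection kills.\<close>

lemma ex_partial_inverse:
  "\<exists>W. \<forall>i. Vector_Spaces.linear scale scale (W i) \<and> (i < d \<longrightarrow> W i ` U (Suc i) \<subseteq> U i)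
     \<and> (\<forall>u\<in>U i. 2 * i < d \<longrightarrow> W i (R u) = u)
     \<and> (\<forall>u\<in>U (Suc i). i < d \<longrightarrow> d \<le> 2 * i + 1 \<longrightarrow> R (W i u) = u)
     \<and> (\<forall>u\<in>U (Suc i). 2 * i + 2 \<le> d \<longrightarrow> (R ^^ (d - 2 * i - 1)) u = 0 \<longrightarrow> W i u = 0)"
proof -
  have "\<exists>W. Vector_Spaces.linear scale scale W \<and> (i < d \<longrightarrow> W ` U (Suc i) \<subseteq> U i)
     \<and> (\<forall>u\<in>U i. 2 * i < d \<longrightarrow> W (R u) = u)
     \<and> (\<forall>u\<in>U (Suc i). i < d \<longrightarrow> d \<le> 2 * i + 1 \<longrightarrow> R (W u) = u)
     \<and> (\<forall>u\<in>U (Suc i). 2 * i + 2 \<le> d \<longrightarrow> (R ^^ (d - 2 * i - 1)) u = 0 \<longrightarrow> W u = 0)" for i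
  proof -
    have G: "\<exists>g. range g \<subseteq> U j \<and> Vector_Spaces.linear scale scale g
        \<and> (\<forall>u\<in>U j. g ((R ^^ (d - 2 * j)) u) = u)" if j: "2 * j \<le> d" for j
    proof -
      interpret vector_space_pair scale scale ..
      show ?thesis
        using linear_exists_left_inverse_on[OF linear_R_pow subspace_U bij_betw_imp_inj_on[OF R_bij[OF j]]]
          j by auto
    qed
    consider (low) "2 * i < d" | (high) "d \<le> 2 * i" "i < d" | (out) "d \<le> i" "d \<le> 2 * i" by linarith
    then show ?thesis
    proof cases
      \<comment> \<open>The inverse of \<open>R\<^sup>d\<^sup>-\<^sup>2\<^sup>i\<close> on \<open>U\<^sub>i\<close>, after \<open>R\<^sup>d\<^sup>-\<^sup>2\<^sup>i\<^sup>-\<^sup>1\<close>, is a left inverse of \<open>R\<close> with this kernel.\<close>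
      case low
      then obtain g where g: "range g \<subseteq> U i" "Vector_Spaces.linear scale scale g"
        "\<And>u. u \<in> U i \<Longrightarrow> g ((R ^^ (d - 2 * i)) u) = u"
        using G[of i] by auto
      interpret g: Vector_Spaces.linear scale scale g by fact
      let ?n = "d - 2 * i - 1"
      have n: "Suc ?n = d - 2 * i" using low by simp
      have gR: "(g \<circ> R ^^ ?n) (R u) = u" if "u \<in> U i" for u
        using g(3)[OF that] unfolding funpow_Suc_right[of ?n R, unfolded n] by simp
      have "R (g u) = u" if "u \<in> U (Suc i)" "d \<le> 2 * i + 1"
        for u
      proof -
        have d: "d = 2 * i + 1" using low that by simp
        then have "bij_betw R (U i) (U (Suc i))" using R_bij[of i] by simp
        then obtain w where "w \<in> U i" "u = R w"
          using \<open>u \<in> U (Suc i)\<close> unfolding bij_betw_def by auto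
        then show ?thesis using g(3)[of w] d by simp
      qed
      moreover have "Vector_Spaces.linear scale scale (g \<circ> R ^^ ?n)"
        by (rule Vector_Spaces.linear_compose[OF linear_R_pow g(2)])
      moreover have "R ((g \<circ> R ^^ ?n) u) = R (g u)" if "d \<le> 2 * i + 1" for u
        using that by simp
      moreover have "(g \<circ> R ^^ ?n) u \<in> U i" for u
        using g(1) by auto
      moreover have "(g \<circ> R ^^ ?n) u = 0" if "(R ^^ ?n) u = 0" for u
        using that by (simp add: g.zero)
      ultimately show ?thesis
        using gR by (intro exI[of _ "g \<circ> R ^^ ?n"] conjI impI ballI image_subsetI) metis+
    next
      \<comment> \<open>Go back from \<open>U\<^sub>i\<^sub>+\<^sub>1\<close> to \<open>U\<^sub>j\<close> with \<open>j = d - i - 1\<close> by the Lefschetz bijection, then up to \<open>U\<^sub>i\<close> by \<open>R\<close>.\<close>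
      case high
      define j where "j = d - Suc i"
      have j: "2 * j \<le> d" using high by (simp add: j_def)
      obtain g where g: "range g \<subseteq> U j" "Vector_Spaces.linear scale scale g"
        "\<And>u. u \<in> U j \<Longrightarrow> g ((R ^^ (d - 2 * j)) u) = u"
        using G[OF j] by blast
      let ?n = "i - j"
      have n: "d - 2 * j = Suc ?n" "j + ?n = i" "d - j = Suc i" using high by (auto simp: j_def)
      have "R ((R ^^ ?n) (g u)) = u" if u: "u \<in> U (Suc i)" for u
      proof -
        have "(R ^^ Suc ?n) ` U j = U (Suc i)"
          using bij_betw_imp_surj_on[OF R_bij[OF j]] by (simp only: n)
        then obtain w where w: "w \<in> U j" "u = (R ^^ Suc ?n) w"
          using u by blast
        then have "g u = w" using g(3)[OF w(1)] by (simp only: n)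
        then show ?thesis unfolding w(2) by simp
      qed
      moreover have "(R ^^ ?n) (g u) \<in> U i" for u
      proof -
        have "g u \<in> U j" using g(1) by blast
        then show ?thesis
          using R_pow_raises[of j ?n "g u"] high(2) by (simp only: n less_imp_le)
      qed
      ultimately show ?thesis
        using high(1) Vector_Spaces.linear_compose[OF g(2) linear_R_pow[of ?n]]
        by (intro exI[of _ "R ^^ ?n \<circ> g"] conjI impI ballI image_subsetI) simp_all
    next
      \<comment> \<open>All conditions except linearity are vacuous here, so any linear map serves as \<open>W\<^sub>i\<close>.\<close>
      case out
      then show ?thesis
        using R_linear by (intro exI[of _ R] conjI impI ballI) simp_all
    qed
  qed
  then show ?thesis by (intro choice allI)
qed

text \<open>The relation forces \<open>e (R w) = R (e w) + [d - 2i] w\<close> for \<open>w\<close> in \<open>U\<^sub>i\<close>; putting \<open>w = W\<^sub>i u\<close> gives a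
  recursive definition of \<open>e\<close> on \<open>U\<^sub>i\<^sub>+\<^sub>1\<close>. Below the middle it satisfies the relation because \<open>W\<^sub>i\<close>
  inverts \<open>R\<close> on the left. Above the middle the relation can fail only by the effect of
  \<open>R e + [d - 2i]\<close> on the kernel of \<open>R\<close> in \<open>U\<^sub>i\<close>. That kernel consists of the vectors \<open>R\<^sup>n p\<close> with
  \<open>n = 2i - d\<close> and \<open>p\<close> primitive in \<open>U\<^sub>d\<^sub>-\<^sub>i\<close>, and on these the relation in lower degrees gives
  \<open>e R\<^sup>n p = [n] R\<^sup>n\<^sup>-\<^sup>1 p\<close>.\<close>

lemma ex_raising_operator:
  obtains e where "Vector_Spaces.linear scale scale e"
    and "\<And>i u. i < d \<Longrightarrow> u \<in> U (Suc i) \<Longrightarrow> e u \<in> U i"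
    and "\<And>u. u \<in> U 0 \<Longrightarrow> e u = 0"
    and "\<And>i u. i \<le> d \<Longrightarrow> u \<in> U i \<Longrightarrow> e (R u) = R (e u) + scale (qi q (int d - 2 * int i)) u"
proof -
  obtain W where W_linear: "\<And>i. Vector_Spaces.linear scale scale (W i)"
    and W_lowers: "\<And>i u. i < d \<Longrightarrow> u \<in> U (Suc i) \<Longrightarrow> W i u \<in> U i"
    and W_R: "\<And>i u. 2 * i < d \<Longrightarrow> u \<in> U i \<Longrightarrow> W i (R u) = u"
    and R_W: "\<And>i u. i < d \<Longrightarrow> d \<le> 2 * i + 1 \<Longrightarrow> u \<in> U (Suc i) \<Longrightarrow> R (W i u) = u"
    and W_primitive: "\<And>i u. 2 * i + 2 \<le> d \<Longrightarrow> u \<in> U (Suc i) \<Longrightarrow>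
        (R ^^ (d - 2 * i - 1)) u = 0 \<Longrightarrow> W i u = 0"
  proof -
    obtain W where W: "\<forall>i. Vector_Spaces.linear scale scale (W i) \<and> (i < d \<longrightarrow> W i ` U (Suc i) \<subseteq> U i)
     \<and> (\<forall>u\<in>U i. 2 * i < d \<longrightarrow> W i (R u) = u)
     \<and> (\<forall>u\<in>U (Suc i). i < d \<longrightarrow> d \<le> 2 * i + 1 \<longrightarrow> R (W i u) = u)
     \<and> (\<forall>u\<in>U (Suc i). 2 * i + 2 \<le> d \<longrightarrow> (R ^^ (d - 2 * i - 1)) u = 0 \<longrightarrow> W i u = 0)"
      using ex_partial_inverse by (rule exE)
    show thesis
      by (rule that[of W]) (use W in blast)+
  qed
  define h where "h i = qi q (int d - 2 * int i)" for i
  define r where "r = rec_nat (\<lambda>v. 0) (\<lambda>i r v. R (r (W i v)) + scale (h i) (W i v))"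
  have r_0: "r 0 v = 0" for v by (simp add: r_def)
  have r_Suc: "r (Suc i) v = R (r i (W i v)) + scale (h i) (W i v)" for i v by (simp add: r_def)
  have r_linear: "Vector_Spaces.linear scale scale (r i)" for i
  proof (induction i)
    case 0
    then show ?case unfolding r_0 by unfold_locales (simp_all add: algebra_simps)
  next
    case (Suc i)
    interpret W: Vector_Spaces.linear scale scale "W i" by (rule W_linear)
    interpret r: Vector_Spaces.linear scale scale "r i" by (rule Suc)
    show ?case
      by unfold_locales
        (simp_all add: r_Suc W.add W.scale r.add r.scale R.add R.scale scale_right_distrib
          scale_left_commute)
  qed
  have r_lowers: "r (Suc i) u \<in> U i" if "i < d" "u \<in> U (Suc i)" for i u
    using that
  proof (induction i arbitrary: u)
    case 0
    then show ?case
      using W_lowers[OF 0] by (simp add: r_Suc r_0 subspace_scale subspace_U)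
  next
    case (Suc i)
    have "R (r (Suc i) (W (Suc i) u)) \<in> U (Suc i)"
      using Suc W_lowers[OF Suc.prems] by (intro R_raises) auto
    then show ?case
      unfolding r_Suc[of "Suc i"]
      using Suc.prems W_lowers[OF Suc.prems] by (intro subspace_add subspace_scale subspace_U) auto
  qed
  \<comment> \<open>In top degree \<open>R\<close> vanishes, so there the relation reads \<open>0 = R e u + [-d] u\<close>.\<close>
  have rel: "(if i = d then 0 else r (Suc i) (R u)) = R (r i u) + scale (h i) u"
    if "i \<le> d" "u \<in> U i" for i u
    using that
  proof (induction i arbitrary: u rule: less_induct)
    case (less i)
    interpret r: Vector_Spaces.linear scale scale "r i" by (rule r_linear)
    have kernel: "R (r i x) + scale (h i) x = 0"
      if x: "x \<in> U i" "R x = 0" and i: "d \<le> 2 * i" for x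
    proof -
      define j n where "j = d - i" and "n = 2 * i - d"
      have jn: "j + n = i" "2 * j \<le> d" "d - 2 * j = n" "d - j = i"
        using i less.prems(1) by (auto simp: j_def n_def)
      obtain p where p: "p \<in> U j" "x = (R ^^ n) p"
        using R_bij[OF jn(2)] x(1) unfolding bij_betw_def jn by blast
      have rp: "r j p = 0"
      proof (cases j)
        case 0
        then show ?thesis by (simp add: r_0)
      next
        case (Suc l)
        have "d - 2 * l - 1 = Suc n" using Suc jn by auto
        then have "(R ^^ (d - 2 * l - 1)) p = 0" using x p by simp
        then have "W l p = 0"
          using W_primitive[of l p] Suc jn p by simp
        interpret r': Vector_Spaces.linear scale scale "r l" by (rule r_linear)
        show ?thesis using \<open>W l p = 0\<close> unfolding Suc r_Suc by (simp add: r'.zero R.zero)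
      qed
      have "r (j + m) ((R ^^ m) p) = scale (\<Sum>t<m. qi q (int n - 2 * int t)) ((R ^^ (m - 1)) p)"
        if "m \<le> n" for m
        using that
      proof (induction m)
        case 0
        then show ?case using rp by simp
      next
        case (Suc m)
        let ?x = "(R ^^ m) p"
        have "?x \<in> U (j + m)"
          using p(1) Suc.prems jn less.prems(1) by (intro R_pow_raises) auto
        then have "r (Suc (j + m)) (R ?x) = R (r (j + m) ?x) + scale (h (j + m)) ?x"
          using less.IH[of "j + m" ?x] Suc.prems jn less.prems(1) by (auto split: if_splits)
        moreover have "h (j + m) = qi q (int n - 2 * int m)"
        proof -
          have "int d - 2 * int (j + m) = int n - 2 * int m"
            using jn(2,3) by simp
          then show ?thesis by (simp only: h_def)
        qed
        moreover have "R (scale (\<Sum>t<m. qi q (int n - 2 * int t)) ((R ^^ (m - 1)) p))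
            = scale (\<Sum>t<m. qi q (int n - 2 * int t)) ?x"
          by (cases m) (simp_all add: R.scale R.zero)
        ultimately show ?case
          using Suc by (simp add: scale_left_distrib)
      qed
      from this[of n] have "r i x = scale (qi q (int n)) ((R ^^ (n - 1)) p)"
        unfolding sum_qi p(2) jn by simp
      then have "R (r i x) = scale (qi q (int n)) x"
        unfolding p(2) by (cases n) (simp_all add: R.scale R.zero)
      moreover have "h i = - qi q (int n)"
        using i by (simp add: h_def n_def qi_minus[symmetric])
      ultimately show ?thesis by simp
    qed
    show ?case
    proof (cases "i = d")
      case True
      then show ?thesis using kernel[of u] less.prems R_top by simp
    next
      case False
      then have i: "i < d" using less.prems by simp
      show ?thesis
      proof (cases "2 * i < d")
        case True
        then show ?thesis using False W_R less.prems by (simp add: r_Suc)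
      next
        case high: False
        \<comment> \<open>\<open>R w = R u\<close>, so the defect of the relation at \<open>u\<close> is its value at \<open>w - u\<close> in the kernel.\<close>
        define w where "w = W i (R u)"
        have Ru: "R u \<in> U (Suc i)" using i less.prems by (auto intro: R_raises)
        have "w - u \<in> U i"
          unfolding w_def using less.prems W_lowers[OF i Ru] by (intro subspace_diff subspace_U) auto
        moreover have "R (w - u) = 0"
          using R_W[OF i _ Ru] high by (simp add: R.diff w_def)
        ultimately have "R (r i (w - u)) + scale (h i) (w - u) = 0"
          using high by (intro kernel) auto
        then show ?thesis
          using False by (simp add: r_Suc w_def[symmetric] r.diff R.diff scale_right_diff_distrib
              algebra_simps)
      qed
    qed
  qed
  define e where "e v = (\<Sum>i\<le>d. r i (pr i v))" for v
  have e_hom: "e u = r i u" if "i \<le> d" "u \<in> U i" for i u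
  proof -
    have "r j 0 = 0" for j
      using r_linear[of j] by (metis Vector_Spaces.linear_iff scale_zero_left)
    then have "e u = (\<Sum>j\<le>d. if j = i then r i u else 0)"
      unfolding e_def using that by (intro sum.cong) (auto simp: pr_homogeneous)
    then show ?thesis using that by simp
  qed
  show thesis
  proof
    show "Vector_Spaces.linear scale scale e"
      unfolding e_def Vector_Spaces.linear_iff
      using linear_pr r_linear vector_space_axioms
      by (auto simp: Vector_Spaces.linear_iff sum.distrib scale_sum_right)
    show "e u \<in> U i" if "i < d" "u \<in> U (Suc i)" for i u
      using r_lowers[OF that] e_hom[of "Suc i" u] that by simp
    show "e u = 0" if "u \<in> U 0" for u
      using that e_hom[of 0 u] by (simp add: r_0)
    show "e (R u) = R (e u) + scale (qi q (int d - 2 * int i)) u" if "i \<le> d" "u \<in> U i" for i u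
    proof (cases "i = d")
      case True
      then show ?thesis
        using rel[of i u] that R_top[of u] e_hom[of i u] by (auto simp: h_def e_hom[of 0 0] r_0
            subspace_0[OF subspace_U])
    next
      case False
      then show ?thesis
        using rel[of i u] that R_raises[of i u] e_hom[of i u] e_hom[of "Suc i" "R u"]
        by (simp add: h_def)
    qed
  qed
qed

end

section \<open>Evaluation of the free algebra\<close>

lemma free_algebra_induct [case_names zero single add]:
  fixes a :: "'x free_word \<Rightarrow>\<^sub>0 'k::field"
  assumes zero: "P 0" and single: "\<And>w c. P (Poly_Mapping.single w c)"
    and add: "\<And>a b. P a \<Longrightarrow> P b \<Longrightarrow> P (a + b)"
  shows "P a"
proof -
  have "P (\<Sum>w\<in>S. Poly_Mapping.single w (Poly_Mapping.lookup a w))" if "finite S" for S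
    using that by induction (simp_all add: zero single add)
  moreover have "a = (\<Sum>w\<in>Poly_Mapping.keys a. Poly_Mapping.single w (Poly_Mapping.lookup a w))"
  proof (rule poly_mapping_eqI)
    fix w
    have "Poly_Mapping.lookup (\<Sum>w\<in>S. Poly_Mapping.single w (Poly_Mapping.lookup a w)) v = (if v \<in> S then Poly_Mapping.lookup a v else 0)"
      if "finite S" for S v
      using that by induction (auto simp: lookup_add lookup_single when_def)
    from this[of "Poly_Mapping.keys a" w]
    show "Poly_Mapping.lookup a w = Poly_Mapping.lookup (\<Sum>w\<in>Poly_Mapping.keys a. Poly_Mapping.single w (Poly_Mapping.lookup a w)) w"
      by (simp add: in_keys_iff)
  qed
  ultimately show ?thesis
    by (metis finite_keys)
qed

locale free_algebra_evaluation = scalar_ring s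
  for s :: "'k::field \<Rightarrow> 'a::{ring,monoid_mult}" +
  fixes \<phi> :: "'x \<Rightarrow> 'a"
  assumes \<phi>_central: "\<phi> x \<in> centralizer"
begin

definition word :: "'x free_word \<Rightarrow> 'a" where
  "word w = prod_list (map \<phi> (letters w))"

definition eval :: "('x free_word \<Rightarrow>\<^sub>0 'k) \<Rightarrow> 'a" where
  "eval a = (\<Sum>w\<in>Poly_Mapping.keys a. s (Poly_Mapping.lookup a w) * word w)"

lemma word_add: "word (u + v) = word u * word v"
  by (simp add: word_def plus_free_word_def)

lemma word_central: "word w \<in> centralizer"
proof -
  have "prod_list (map \<phi> xs) \<in> centralizer" for xs
    by (induction xs) (simp_all add: centralizer_closed \<phi>_central)
  then show ?thesis by (simp add: word_def)
qed

lemma eval_superset: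
  assumes "finite S" "Poly_Mapping.keys a \<subseteq> S"
  shows "eval a = (\<Sum>w\<in>S. s (Poly_Mapping.lookup a w) * word w)"
  unfolding eval_def
  by (rule sum.mono_neutral_left) (use assms in \<open>auto simp: in_keys_iff s_0\<close>)

lemma eval_0: "eval 0 = 0"
  by (simp add: eval_def)

lemma eval_add: "eval (a + b) = eval a + eval b"
proof -
  let ?S = "Poly_Mapping.keys a \<union> Poly_Mapping.keys b"
  have "Poly_Mapping.keys (a + b) \<subseteq> ?S" by (rule keys_add)
  then show ?thesis
    by (simp add: eval_superset[of ?S] lookup_add s_add distrib_right sum.distrib)
qed

lemma eval_minus: "eval (- a) = - eval a"
  using eval_add[of a "- a"] by (simp add: eval_0 add_eq_0_iff)

lemma eval_diff: "eval (a - b) = eval a - eval b"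
  using eval_add[of a "- b"] by (simp add: eval_minus)

lemma eval_single: "eval (Poly_Mapping.single w c) = s c * word w"
  by (subst eval_superset[of "{w}"]) (auto simp: lookup_single)

lemma eval_mult: "eval (a * b) = eval a * eval b"
proof (induction a rule: free_algebra_induct)
  case zero
  then show ?case by (simp add: eval_0)
next
  case (single u c)
  show ?case
  proof (induction b rule: free_algebra_induct)
    case zero
    then show ?case by (simp add: eval_0)
  next
    case (single v d)
    then show ?case
      by (simp add: mult_single eval_single word_add s_mult mult.assoc
          centralizer_simps[OF word_central])
  next
    case (add b b')
    then show ?case by (simp add: distrib_left eval_add)
  qed
next
  case (add a a')
  then show ?case by (simp add: distrib_right eval_add)
qed

lemma eval_1: "eval 1 = 1"
proof -
  have "eval (Poly_Mapping.single 0 1) = 1"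
    unfolding eval_single by (simp add: s_1 word_def zero_free_word_def)
  then show ?thesis by simp
qed

lemma eval_power: "eval (a ^ n) = eval a ^ n"
  by (induction n) (simp_all add: eval_1 eval_mult)

lemma eval_gen: "eval (free_gen x) = \<phi> x"
  by (simp add: free_gen_def eval_single s_1 word_def)

lemma eval_scalar: "eval (free_scalar c) = s c"
  by (simp add: free_scalar_def eval_single word_def zero_free_word_def)

lemmas eval_simps = eval_0 eval_1 eval_add eval_minus eval_diff eval_mult eval_power eval_gen
  eval_scalar

lemma ideal_kernel: "ideal {a. eval a = 0} free_algebra"
proof (rule idealI[OF ring_free_algebra])
  show "subgroup {a. eval a = 0} (add_monoid free_algebra)"
  proof (unfold_locales)
    fix x assume "x \<in> {a. eval a = 0}"
    moreover have "inv\<^bsub>add_monoid free_algebra\<^esub> x = - x"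
    proof (rule group.inv_equality)
      show "Group.group (add_monoid (free_algebra :: ('x free_word \<Rightarrow>\<^sub>0 'k) ring))"
        using ring_free_algebra by (meson abelian_group.a_group ring.is_abelian_group)
    qed (simp_all add: free_algebra_def)
    ultimately show "inv\<^bsub>add_monoid free_algebra\<^esub> x \<in> {a. eval a = 0}"
      by (simp add: eval_minus)
  qed (simp_all add: free_algebra_def eval_0 eval_add)
qed (simp_all add: free_algebra_def eval_mult)

end

section \<open>Modules over the presented algebra\<close>

lemma uq_class_eq_iff: "uq_class q a = uq_class q b \<longleftrightarrow> a - b \<in> uq_ideal q"
proof -
  interpret ideal "uq_ideal q" free_algebra by (rule ideal_uq_ideal)
  have mem: "c \<in> uq_class q d \<longleftrightarrow> c - d \<in> uq_ideal q" for c d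
  proof
    assume "c \<in> uq_class q d"
    then show "c - d \<in> uq_ideal q"
      by (auto simp: uq_class_def a_r_coset_def r_coset_def free_algebra_def)
  next
    assume "c - d \<in> uq_ideal q"
    then show "c \<in> uq_class q d"
      by (auto simp: uq_class_def a_r_coset_def r_coset_def free_algebra_def
          intro!: bexI[of _ "c - d"])
  qed
  have carr: "x \<in> carrier free_algebra" for x :: "chevalley free_word \<Rightarrow>\<^sub>0 'a"
    by (simp add: free_algebra_def)
  have "uq_class q a = uq_class q b \<longleftrightarrow> a \<in> uq_class q b"
    using a_repr_independence'[OF _ carr, of a b] a_rcos_self[OF carr, of a]
    unfolding uq_class_def by metis
  then show ?thesis by (simp add: mem)
qed

lemma uq_operations:
  "carrier (uq q) = range (uq_class q)"
  "uq_class q a \<oplus>\<^bsub>uq q\<^esub> uq_class q b = uq_class q (a + b)"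
  "uq_class q a \<otimes>\<^bsub>uq q\<^esub> uq_class q b = uq_class q (a * b)"
  "\<one>\<^bsub>uq q\<^esub> = uq_class q 1"
proof -
  interpret ideal "uq_ideal q" free_algebra by (rule ideal_uq_ideal)
  note h = rcos_ring_hom
  have [simp]: "x \<in> carrier free_algebra" for x :: "chevalley free_word \<Rightarrow>\<^sub>0 'a"
    by (simp add: free_algebra_def)
  show "carrier (uq q) = range (uq_class q)"
    by (auto simp: uq_def FactRing_def A_RCOSETS_def RCOSETS_def uq_class_def a_r_coset_def)
  show "uq_class q a \<oplus>\<^bsub>uq q\<^esub> uq_class q b = uq_class q (a + b)"
    using ring_hom_add[OF h, of a b] by (simp add: uq_def uq_class_def) (simp add: free_algebra_def)
  show "uq_class q a \<otimes>\<^bsub>uq q\<^esub> uq_class q b = uq_class q (a * b)"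
    using ring_hom_mult[OF h, of a b] by (simp add: uq_def uq_class_def) (simp add: free_algebra_def)
  show "\<one>\<^bsub>uq q\<^esub> = uq_class q 1"
    using ring_hom_one[OF h] by (simp add: uq_def uq_class_def) (simp add: free_algebra_def)
qed

text \<open>Additivity, unlike linearity, can be expressed without the scalar multiplication, which is a term
  and cannot enter the definition of a type.\<close>

typedef (overloaded) 'v add_end = "{f :: 'v::ab_group_add \<Rightarrow> 'v. \<forall>x y. f (x + y) = f x + f y}"
  morphisms app Add_End
  by (rule exI[of _ id]) simp

setup_lifting type_definition_add_end

instantiation add_end :: (ab_group_add) "{ring, monoid_mult}"
begin

lift_definition zero_add_end :: "'a add_end" is "\<lambda>v. 0" by simp
lift_definition one_add_end :: "'a add_end" is "\<lambda>v. v" by simp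
lift_definition plus_add_end :: "'a add_end \<Rightarrow> 'a add_end \<Rightarrow> 'a add_end"
  is "\<lambda>f g v. f v + g v" by (simp add: algebra_simps)
lift_definition minus_add_end :: "'a add_end \<Rightarrow> 'a add_end \<Rightarrow> 'a add_end"
  is "\<lambda>f g v. f v - g v" by (simp add: algebra_simps)
lift_definition uminus_add_end :: "'a add_end \<Rightarrow> 'a add_end" is "\<lambda>f v. - f v" by simp
lift_definition times_add_end :: "'a add_end \<Rightarrow> 'a add_end \<Rightarrow> 'a add_end"
  is "\<lambda>f g v. f (g v)" by simp

instance
  by standard (transfer; simp add: algebra_simps)+

end

lemma add_end_eqI: "(\<And>v. app f v = app g v) \<Longrightarrow> f = g"
  by (metis app_inject ext)

lemma app_simps [simp]:
  "app 0 v = 0" "app 1 v = v" "app (f + g) v = app f v + app g v"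
  "app (f - g) v = app f v - app g v" "app (- f) v = - app f v" "app (f * g) v = app f (app g v)"
  by (simp_all add: zero_add_end.rep_eq one_add_end.rep_eq plus_add_end.rep_eq
      minus_add_end.rep_eq uminus_add_end.rep_eq times_add_end.rep_eq)

lemma app_add: "app f (x + y) = app f x + app f y"
  using app[of f] by simp

definition homothety :: "('k \<Rightarrow> 'v \<Rightarrow> 'v::ab_group_add) \<Rightarrow> 'k \<Rightarrow> 'v add_end" where
  "homothety sc c = Add_End (sc c)"

context vector_space
begin

lemma app_homothety [simp]: "app (homothety scale c) v = scale c v"
  by (simp add: homothety_def Add_End_inverse scale_right_distrib)

lemma scalar_ring_homothety: "scalar_ring (homothety scale)"
  by unfold_locales (auto intro!: add_end_eqI simp: scale_left_distrib)

lemma centralizer_iff_linear: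
  "f \<in> scalar_ring.centralizer (homothety scale) \<longleftrightarrow> Vector_Spaces.linear scale scale (app f)"
proof -
  have "f \<in> scalar_ring.centralizer (homothety scale) \<longleftrightarrow> (\<forall>c. homothety scale c * f = f * homothety scale c)"
    by (simp add: scalar_ring.centralizer_def[OF scalar_ring_homothety])
  also have "\<dots> \<longleftrightarrow> (\<forall>c v. scale c (app f v) = app f (scale c v))"
    by (metis add_end_eqI app_simps(6) app_homothety)
  also have "\<dots> \<longleftrightarrow> Vector_Spaces.linear scale scale (app f)"
    using vector_space_axioms by (auto simp: Vector_Spaces.linear_iff app_add)
  finally show ?thesis .
qed

lemma app_Add_End_linear:
  assumes "Vector_Spaces.linear scale scale f"
  shows "app (Add_End f) = f"
  using assms by (intro Add_End_inverse) (simp add: Vector_Spaces.linear_iff)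

text \<open>The universal property of the presentation. A class acts by evaluating any representative; this is
  well defined since the kernel of the evaluation is an ideal that contains the relators.\<close>

lemma ex_uq_module_of_evaluation:
  assumes ev: "free_algebra_evaluation (homothety scale) \<phi>"
    and rel: "\<And>r. r \<in> uq_relators q \<Longrightarrow> free_algebra_evaluation.eval (homothety scale) \<phi> r = 0"
  shows "\<exists>act. uq_module_structure q scale act \<and> (\<forall>x v. act (uq_gen q x) v = app (\<phi> x) v)"
proof -
  interpret free_algebra_evaluation "homothety scale" \<phi> by (rule ev)
  have "uq_ideal q \<subseteq> {a. eval a = 0}"
    unfolding uq_ideal_def
    by (rule ring.genideal_minimal[OF ring_free_algebra ideal_kernel]) (auto simp: rel)
  then have wd: "eval a = eval b" if "uq_class q a = uq_class q b" for a b
    using that by (auto simp: uq_class_eq_iff eval_diff)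
  define act where "act = (\<lambda>A. if A \<in> carrier (uq q) then app (eval (SOME a. uq_class q a = A))
     else undefined)"
  have act: "act (uq_class q a) = app (eval a)" for a
  proof -
    have "uq_class q (SOME b. uq_class q b = uq_class q a) = uq_class q a"
      by (rule someI) (rule refl)
    then have "eval (SOME b. uq_class q b = uq_class q a) = eval a"
      by (rule wd)
    then show ?thesis
      by (simp add: act_def uq_operations)
  qed
  have eval_central: "eval a \<in> centralizer" for a
    by (induction a rule: free_algebra_induct)
      (simp_all add: eval_simps eval_single centralizer_closed word_central)
  have "uq_module_structure q scale act"
    unfolding algebra_module_structure_def
  proof (intro conjI allI ballI)
    show "act \<in> extensional (carrier (uq q))"
      by (simp add: act_def extensional_def)
    show "Vector_Spaces.linear scale scale (act A)" if "A \<in> carrier (uq q)" for A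
      using that eval_central by (auto simp: uq_operations act centralizer_iff_linear)
  qed (auto simp: uq_operations act eval_simps uq_scalar_def)
  moreover have "act (uq_gen q x) v = app (\<phi> x) v" for x v
    by (simp add: uq_gen_def act eval_gen)
  ultimately show ?thesis by blast
qed

text \<open>Conversely a module is recovered from the action of the generators, by induction on words.\<close>

lemma evaluation_of_uq_module:
  assumes act: "uq_module_structure q scale act"
  defines "\<phi> \<equiv> \<lambda>x. Add_End (act (uq_gen q x))"
  shows "free_algebra_evaluation (homothety scale) \<phi>"
    and "app (\<phi> x) = act (uq_gen q x)"
    and "app (free_algebra_evaluation.eval (homothety scale) \<phi> a) = act (uq_class q a)"
    and "r \<in> uq_relators q \<Longrightarrow> free_algebra_evaluation.eval (homothety scale) \<phi> r = 0"
proof -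
  have act_linear: "Vector_Spaces.linear scale scale (act (uq_class q a))"
    and act_add: "act (uq_class q (a + b)) v = act (uq_class q a) v + act (uq_class q b) v"
    and act_mult: "act (uq_class q (a * b)) v = act (uq_class q a) (act (uq_class q b) v)"
    and act_1: "act (uq_class q 1) v = v"
    and act_scalar: "act (uq_class q (free_scalar c)) v = scale c v" for a b c v
    using act by (auto simp: algebra_module_structure_def uq_operations uq_scalar_def)
  show app_\<phi>: "app (\<phi> x) = act (uq_gen q x)" for x
    unfolding \<phi>_def uq_gen_def by (rule app_Add_End_linear[OF act_linear])
  show ev: "free_algebra_evaluation (homothety scale) \<phi>"
  proof -
    interpret scalar_ring "homothety scale" by (rule scalar_ring_homothety)
    show ?thesis
      by unfold_locales (simp add: centralizer_iff_linear app_\<phi> uq_gen_def act_linear)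
  qed
  interpret free_algebra_evaluation "homothety scale" \<phi> by (rule ev)
  have word: "app (word w) v = act (uq_class q (Poly_Mapping.single w 1)) v" for w v
  proof -
    have "app (prod_list (map \<phi> xs)) v = act (uq_class q (Poly_Mapping.single (FWord xs) 1)) v"
      for xs v
    proof (induction xs arbitrary: v)
      case Nil
      then show ?case
        using act_1 by (simp add: zero_free_word_def[symmetric])
    next
      case (Cons x xs)
      have "Poly_Mapping.single (FWord (x # xs)) (1::'a)
          = free_gen x * Poly_Mapping.single (FWord xs) 1"
        by (simp add: free_gen_def mult_single plus_free_word_def)
      then show ?case
        by (simp add: Cons app_\<phi> act_mult uq_gen_def)
    qed
    then show ?thesis by (simp add: word_def)
  qed
  have eval_act: "app (eval a) v = act (uq_class q a) v" for a v
  proof (induction a rule: free_algebra_induct)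
    case zero
    show ?case using act_add[of 0 0 v] by (simp add: eval_0)
  next
    case (single w c)
    have "act (uq_class q (free_scalar c * Poly_Mapping.single w 1)) v
        = scale c (act (uq_class q (Poly_Mapping.single w 1)) v)"
      by (simp only: act_mult act_scalar)
    moreover have "free_scalar c * Poly_Mapping.single w 1 = Poly_Mapping.single w c"
      by (simp add: free_scalar_def mult_single)
    ultimately show ?case by (simp add: eval_single word)
  next
    case (add a b)
    then show ?case by (simp add: eval_add act_add)
  qed
  then show "app (eval a) = act (uq_class q a)" for a by blast
  show "eval r = 0" if "r \<in> uq_relators q" for r
  proof (rule add_end_eqI)
    fix v
    interpret I: ideal "uq_ideal q" free_algebra by (rule ideal_uq_ideal)
    have "r \<in> uq_ideal q"
      using ring.genideal_self[OF ring_free_algebra, of "uq_relators q"] that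
      by (auto simp: uq_ideal_def free_algebra_def)
    then have "uq_class q r = uq_class q 0"
      by (simp add: uq_class_eq_iff)
    then show "app (eval r) v = app 0 v"
      using eval_act[of r v] eval_act[of 0 v] by (simp add: eval_0)
  qed
qed

end

definition uq_relations :: "('k::field \<Rightarrow> 'a::{ring,monoid_mult}) \<Rightarrow> 'k \<Rightarrow> (chevalley \<Rightarrow> 'a) \<Rightarrow> bool"
  where "uq_relations s q \<phi> \<longleftrightarrow>
     (\<forall>i. \<phi> (K i) * \<phi> (Kinv i) = 1) \<and>
     (\<forall>i. \<phi> (Kinv i) * \<phi> (K i) = 1) \<and>
     \<phi> (K N0) * \<phi> (K N1) = \<phi> (K N1) * \<phi> (K N0) \<and>
     (\<forall>i t. \<phi> (K i) * \<phi> (E t i) * \<phi> (Kinv i) = s (q powi (2 * sign_int t)) * \<phi> (E t i)) \<and>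
     (\<forall>i j t. i \<noteq> j \<longrightarrow>
        \<phi> (K i) * \<phi> (E t j) * \<phi> (Kinv i) = s (q powi (- 2 * sign_int t)) * \<phi> (E t j)) \<and>
     (\<forall>i. \<phi> (E Pos i) * \<phi> (E Neg i) - \<phi> (E Neg i) * \<phi> (E Pos i)
        = s (1 / (q - inverse q)) * (\<phi> (K i) - \<phi> (Kinv i))) \<and>
     (\<forall>t u. t \<noteq> u \<longrightarrow> \<phi> (E t N0) * \<phi> (E u N1) = \<phi> (E u N1) * \<phi> (E t N0)) \<and>
     (\<forall>i j t. i \<noteq> j \<longrightarrow> serre (s (qint q 3)) (\<phi> (E t i)) (\<phi> (E t j)) = 0)"

lemma ball_setcompr:
  "(\<forall>r\<in>{g1 i |i. P1 i}. Q r) \<longleftrightarrow> (\<forall>i. P1 i \<longrightarrow> Q (g1 i))"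
  "(\<forall>r\<in>{g2 i j |i j. P2 i j}. Q r) \<longleftrightarrow> (\<forall>i j. P2 i j \<longrightarrow> Q (g2 i j))"
  "(\<forall>r\<in>{g3 i j k |i j k. P3 i j k}. Q r) \<longleftrightarrow> (\<forall>i j k. P3 i j k \<longrightarrow> Q (g3 i j k))"
  by blast+

lemma uq_relations_iff:
  assumes "free_algebra_evaluation s \<phi>"
  shows "(\<forall>r\<in>uq_relators q. free_algebra_evaluation.eval s \<phi> r = 0) \<longleftrightarrow> uq_relations s q \<phi>"
proof -
  interpret free_algebra_evaluation s \<phi> by fact
  show ?thesis
    unfolding uq_relators_def Let_def uq_relations_def serre_def ball_Un ball_setcompr
      ball_simps eval_simps
    by (simp only: right_minus_eq conj_assoc simp_thms)
qed

section \<open>Two quantum \<open>sl\<^sub>2\<close> linked by the cubic relations\<close>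

text \<open>With \<open>R\<close> as lowering operator the Cartan element is the inverse of \<open>\<kappa>\<close>. Conjugation by it multiplies
  an endomorphism that maps \<open>U\<^sub>i\<close> to \<open>U\<^sub>j\<close> by \<open>q\<^sup>2\<^sup>(\<^sup>i\<^sup>-\<^sup>j\<^sup>)\<close>, whence the bound \<open>2d\<close> on the weights.\<close>

lemma (in lefschetz) ex_quantum_sl2:
  fixes \<kappa> \<kappa>' :: "'b add_end"
  assumes linear: "Vector_Spaces.linear scale scale (app \<kappa>)"
      "Vector_Spaces.linear scale scale (app \<kappa>')"
    and \<kappa>: "\<And>i u. i \<le> d \<Longrightarrow> u \<in> U i \<Longrightarrow> app \<kappa> u = scale (q powi (2 * int i - int d)) u"
    and \<kappa>': "\<And>i u. i \<le> d \<Longrightarrow> u \<in> U i \<Longrightarrow> app \<kappa>' u = scale (q powi (int d - 2 * int i)) u"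
  shows "\<exists>e. quantum_sl2 (homothety scale) q e (Add_End R) \<kappa>' \<kappa> (2 * int d)"
proof -
  obtain e where e: "Vector_Spaces.linear scale scale e"
    "\<And>i u. i < d \<Longrightarrow> u \<in> U (Suc i) \<Longrightarrow> e u \<in> U i"
    "\<And>u. u \<in> U 0 \<Longrightarrow> e u = 0"
    "\<And>i u. i \<le> d \<Longrightarrow> u \<in> U i \<Longrightarrow> e (R u) = R (e u) + scale (qi q (int d - 2 * int i)) u"
    using ex_raising_operator by blast
  interpret scalar_ring "homothety scale" by (rule scalar_ring_homothety)
  interpret e: Vector_Spaces.linear scale scale e by (rule e(1))
  define E where "E = Add_End e"
  define F where "F = Add_End R"
  have app [simp]: "app E = e" "app F = R"
    by (simp_all add: E_def F_def app_Add_End_linear e(1) R_linear)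
  have central: "E \<in> centralizer" "F \<in> centralizer" "\<kappa>' \<in> centralizer" "\<kappa> \<in> centralizer"
    by (simp_all add: centralizer_iff_linear e(1) R_linear linear)
  have eqI: "x = y" if "x \<in> centralizer" "y \<in> centralizer"
    and "\<And>i u. i \<le> d \<Longrightarrow> u \<in> U i \<Longrightarrow> app x u = app y u" for x y
    using linear_eqI[of "app x" "app y"] that by (simp add: centralizer_iff_linear app_inject)
  have scale_weight: "app \<kappa>' (scale c u) = scale (c * q powi (int d - 2 * int i)) u"
    "app \<kappa> (scale c u) = scale (c * q powi (2 * int i - int d)) u"
    if "i \<le> d" "u \<in> U i" for c i u
    using \<kappa>[of i "scale c u"] \<kappa>'[of i "scale c u"] that
    by (simp_all add: subspace_scale subspace_U mult.commute)
  have "quantum_sl2 (homothety scale) q E F \<kappa>' \<kappa> (2 * int d)"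
  proof unfold_locales
    show "E \<in> centralizer" "F \<in> centralizer" "\<kappa>' \<in> centralizer" "\<kappa> \<in> centralizer"
      by (fact central)+
    show "\<kappa>' * \<kappa> = 1" "\<kappa> * \<kappa>' = 1"
      by (rule eqI; use q_nonzero in \<open>simp add: centralizer_closed central \<kappa> \<kappa>' scale_weight
          power_int_add[symmetric]\<close>)+
    show "\<kappa>' * E = homothety scale (q powi 2) * E * \<kappa>'"
    proof (rule eqI)
      fix i u assume u: "i \<le> d" "u \<in> U i"
      show "app (\<kappa>' * E) u = app (homothety scale (q powi 2) * E * \<kappa>') u"
      proof (cases i)
        case 0
        then show ?thesis using u e(3) \<kappa>'[of 0] e(3)[of u] \<kappa>'[of 0 0]
          by (simp add: e.scale subspace_0 subspace_U)
      next
        case (Suc j)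
        have "e u \<in> U j" using u Suc e(2)[of j u] by simp
        then have "app \<kappa>' (e u) = scale (q powi (int d - 2 * int j)) (e u)"
          using \<kappa>'[of j "e u"] u Suc by simp
        also have "int d - 2 * int j = 2 + (int d - 2 * int i)"
          using Suc by simp
        also have "q powi \<dots> = q powi 2 * q powi (int d - 2 * int i)"
          using q_nonzero by (intro power_int_add) simp
        finally show ?thesis
          by (simp add: e.scale \<kappa>'[OF u])
      qed
    qed (simp_all add: centralizer_closed central)
    show "\<kappa>' * F = homothety scale (q powi - 2) * F * \<kappa>'"
    proof (rule eqI)
      fix i u assume u: "i \<le> d" "u \<in> U i"
      show "app (\<kappa>' * F) u = app (homothety scale (q powi - 2) * F * \<kappa>') u"
      proof (cases "i = d")
        case True
        then show ?thesis using u R_top[of u] \<kappa>'[of i u] \<kappa>'[of d 0]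
          by (simp add: R.scale subspace_0 subspace_U)
      next
        case False
        have "app \<kappa>' (R u) = scale (q powi (int d - 2 * int (Suc i))) (R u)"
          using \<kappa>'[of "Suc i" "R u"] R_raises[of i u] u False by simp
        also have "int d - 2 * int (Suc i) = - 2 + (int d - 2 * int i)"
          by simp
        also have "q powi \<dots> = q powi (- 2) * q powi (int d - 2 * int i)"
          using q_nonzero by (intro power_int_add) simp
        finally show ?thesis
          by (simp add: R.scale \<kappa>'[OF u])
      qed
    qed (simp_all add: centralizer_closed central)
    show "E * F - F * E = homothety scale (1 / (q - inverse q)) * (\<kappa>' - \<kappa>)"
    proof (rule eqI)
      fix i u assume u: "i \<le> d" "u \<in> U i"
      show "app (E * F - F * E) u = app (homothety scale (1 / (q - inverse q)) * (\<kappa>' - \<kappa>)) u"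
        using e(4)[OF u] \<kappa>[OF u] \<kappa>'[OF u]
        by (simp add: qi_def scale_left_diff_distrib[symmetric])
    qed (simp_all add: centralizer_closed central)
    fix y n
    assume y: "y \<in> centralizer" "\<kappa>' * y = homothety scale (q powi n) * y * \<kappa>'"
      and n: "n > 2 * int d"
    interpret y: Vector_Spaces.linear scale scale "app y"
      using y(1) by (simp add: centralizer_iff_linear)
    show "y = 0"
    proof (rule eqI)
      fix i u assume u: "i \<le> d" "u \<in> U i"
      have "app y u = 0"
      proof (rule no_other_eigenvalue[OF linear(2) \<kappa>'])
        have "app (\<kappa>' * y) u = scale (q powi n * q powi (int d - 2 * int i)) (app y u)"
          unfolding y(2) using \<kappa>'[OF u] by (simp add: y.scale)
        then show "app \<kappa>' (app y u) = scale (q powi (n + (int d - 2 * int i))) (app y u)"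
          using q_nonzero by (simp add: power_int_add)
        show "q powi (n + (int d - 2 * int i)) \<noteq> q powi (int d - 2 * int j)" if "j \<le> d" for j
          using n u by (simp add: powi_eq_iff)
      qed
      then show "app y u = app 0 u" by simp
    qed (simp_all add: y centralizer_closed)
  qed
  then show ?thesis unfolding F_def by blast
qed

lemma uq_module_ext:
  assumes "uq_module_structure q scale act" "uq_module_structure q scale act'"
    and "vector_space scale"
    and "\<And>x. act (uq_gen q x) = act' (uq_gen q x)"
  shows "act = act'"
proof
  interpret vector_space scale by fact
  fix A
  show "act A = act' A"
  proof (cases "A \<in> carrier (uq q)")
    case True
    then obtain a where "A = uq_class q a" by (auto simp: uq_operations)
    then show ?thesis
      using evaluation_of_uq_module(3)[OF assms(1), of a]
        evaluation_of_uq_module(3)[OF assms(2), of a] assms(4) by simp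
  next
    case False
    have ext: "act \<in> extensional (carrier (uq q))" "act' \<in> extensional (carrier (uq q))"
      using assms(1,2)[unfolded algebra_module_structure_def, THEN conjunct1] by this+
    show ?thesis
      using extensional_arb[OF ext(1) False] extensional_arb[OF ext(2) False] by (rule trans[OF _ sym])
  qed
qed

lemma weight_if_conjugation:
  assumes "\<kappa> * x * \<kappa>' = s * x" "\<kappa>' * \<kappa> = (1 :: 'a::{ring,monoid_mult})"
  shows "\<kappa> * x = s * x * \<kappa>"
proof -
  have "\<kappa> * x = \<kappa> * x * (\<kappa>' * \<kappa>)" by (simp add: assms(2))
  also have "\<dots> = s * x * \<kappa>" by (simp add: mult.assoc[symmetric] assms(1))
  finally show ?thesis .
qed

lemma node_all: "(\<forall>i. P i) \<longleftrightarrow> P N0 \<and> P N1"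
  using node.exhaust by (metis (full_types))

lemma sign_all: "(\<forall>t. P t) \<longleftrightarrow> P Pos \<and> P Neg"
  using sign.exhaust by (metis (full_types))

text \<open>The two copies of \<open>U\<^sub>q(sl\<^sub>2)\<close> attached to the nodes have mutually inverse Cartan elements. Of the
  relations between the nodes only those for the lowering elements \<open>l\<close> and \<open>r\<close> are assumed.\<close>

locale quantum_affine_sl2_pair =
  A0: quantum_sl2 s q e0 l \<kappa> \<kappa>' N + A1: quantum_sl2 s q e1 r \<kappa>' \<kappa> N
  for s :: "'k::field \<Rightarrow> 'a::{ring,monoid_mult}" and q e0 l \<kappa> \<kappa>' e1 r N +
  assumes serre_r_l: "serre (s (qint q 3)) r l = 0" and serre_l_r: "serre (s (qint q 3)) l r = 0"
begin

fun gen :: "chevalley \<Rightarrow> 'a" where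
  "gen (E Pos N0) = e0"
| "gen (E Pos N1) = e1"
| "gen (E Neg N0) = l"
| "gen (E Neg N1) = r"
| "gen (K N0) = \<kappa>"
| "gen (K N1) = \<kappa>'"
| "gen (Kinv N0) = \<kappa>'"
| "gen (Kinv N1) = \<kappa>"

lemma weight_opposite: "x \<in> A0.weight n \<longleftrightarrow> x \<in> A1.weight (- n)"
proof
  assume x: "x \<in> A0.weight n"
  show "x \<in> A1.weight (- n)"
    using A0.weight_k'[OF x] A0.weight_central[OF x] by (simp add: A1.weight_def mult.assoc)
next
  assume x: "x \<in> A1.weight (- n)"
  show "x \<in> A0.weight n"
    using A1.weight_k'[OF x] A1.weight_central[OF x] by (simp add: A0.weight_def mult.assoc)
qed

lemma weights:
  "e0 \<in> A0.weight 2" "l \<in> A0.weight (-2)" "e1 \<in> A0.weight (-2)" "r \<in> A0.weight 2"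
  "e0 \<in> A1.weight (-2)" "l \<in> A1.weight 2" "e1 \<in> A1.weight 2" "r \<in> A1.weight (-2)"
proof -
  show A: "e0 \<in> A0.weight 2" "l \<in> A0.weight (-2)" "e1 \<in> A1.weight 2" "r \<in> A1.weight (-2)"
    by (rule A0.generator_weights A1.generator_weights)+
  show "e1 \<in> A0.weight (-2)" "r \<in> A0.weight 2" "e0 \<in> A1.weight (-2)" "l \<in> A1.weight 2"
    using A weight_opposite[of e0 2] weight_opposite[of l "-2"]
    by (simp_all add: weight_opposite)
qed

lemma conjugation:
  "x \<in> A0.weight n \<Longrightarrow> \<kappa> * x * \<kappa>' = s (q powi n) * x"
  "x \<in> A1.weight n \<Longrightarrow> \<kappa>' * x * \<kappa> = s (q powi n) * x"
  using A0.weight_k[of x n] A1.weight_k[of x n] by (simp_all add: mult.assoc A0.k_inverse)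

text \<open>The cubic relation for \<open>l, r\<close> makes each raising element commute with the lowering element of the
  other node, and this in turn gives the cubic relation for the raising elements.\<close>

lemma gen_uq_relations: "uq_relations s q gen"
proof -
  have e0_r: "e0 * r = r * e0"
    by (rule A0.commute_if_serre[OF weights(4) serre_l_r])
  have e1_l: "e1 * l = l * e1"
    by (rule A1.commute_if_serre[OF weights(6) serre_r_l])
  have "serre (s (qint q 3)) e0 e1 = 0"
    by (rule A0.serre_if_commute[OF weights(3) e1_l[symmetric]])
  moreover have "serre (s (qint q 3)) e1 e0 = 0"
    by (rule A1.serre_if_commute[OF weights(5) e0_r[symmetric]])
  ultimately show ?thesis
    unfolding uq_relations_def
    using e0_r e1_l serre_r_l serre_l_r A0.k_inverse A0.e_f A1.e_f weights(1-4)[THEN conjugation(1)]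
      weights(5-8)[THEN conjugation(2)]
    by (simp add: node_all sign_all)
qed

lemma gen_central: "gen x \<in> A0.centralizer"
  using A0.central A1.central by (cases x rule: gen.cases) simp_all

text \<open>Inverses are unique, and within each copy of \<open>U\<^sub>q(sl\<^sub>2)\<close> the raising element is determined by the
  other generators.\<close>

lemma gen_unique:
  assumes ev: "\<And>x. \<phi> x \<in> A0.centralizer" and rel: "uq_relations s q \<phi>"
    and \<phi>: "\<phi> (E Neg N0) = l" "\<phi> (E Neg N1) = r" "\<phi> (K N0) = \<kappa>" "\<phi> (K N1) = \<kappa>'"
  shows "\<phi> x = gen x"
proof -
  have inv: "y = z" if "x * y = 1" "z * x = 1" for x y z :: 'a
    using that by (metis mult.assoc mult_1_left mult_1_right)
  have KKinv: "\<phi> (K i) * \<phi> (Kinv i) = 1" for i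
    using rel by (simp add: uq_relations_def)
  have Kinv: "\<phi> (Kinv N0) = \<kappa>'" "\<phi> (Kinv N1) = \<kappa>"
    using inv[OF KKinv[of N0]] inv[OF KKinv[of N1]] A0.k_inverse by (simp_all add: \<phi>)
  have "\<phi> (K i) * \<phi> (E t i) * \<phi> (Kinv i) = s (q powi (2 * sign_int t)) * \<phi> (E t i)" for i t
    using rel by (simp add: uq_relations_def)
  from this[of _ Pos]
  have conj: "\<phi> (K i) * \<phi> (E Pos i) * \<phi> (Kinv i) = s (q powi 2) * \<phi> (E Pos i)"
for i
    by simp
  have comm: "\<phi> (E Pos i) * \<phi> (E Neg i) - \<phi> (E Neg i) * \<phi> (E Pos i)
        = s (1 / (q - inverse q)) * (\<phi> (K i) - \<phi> (Kinv i))" for i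
    using rel by (simp add: uq_relations_def)
  have "\<phi> (E Pos N0) = e0"
  proof (rule A0.raising_unique)
    show "\<phi> (E Pos N0) \<in> A0.weight 2"
      using weight_if_conjugation[OF conj[of N0]] ev
      by (simp add: A0.weight_def \<phi> Kinv A0.k_inverse)
  qed (use comm[of N0] in \<open>simp add: \<phi> Kinv\<close>)
  moreover have "\<phi> (E Pos N1) = e1"
  proof (rule A1.raising_unique)
    show "\<phi> (E Pos N1) \<in> A1.weight 2"
      using weight_if_conjugation[OF conj[of N1]] ev
      by (simp add: A1.weight_def \<phi> Kinv A0.k_inverse)
  qed (use comm[of N1] in \<open>simp add: \<phi> Kinv\<close>)
  ultimately show ?thesis
    using \<phi> Kinv by (cases x rule: gen.cases) simp_all
qed

end

section \<open>The module structure\<close>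

text \<open>Needed to treat \<open>L\<close> as the raising map of a grading, on the same footing as \<open>R\<close>.\<close>

lemma decomposition_reverse:
  assumes "decomposition scale d U"
  shows "decomposition scale d (\<lambda>i. U (d - i))"
  unfolding decomposition_def
proof (intro conjI allI impI)
  fix i assume "i \<le> d"
  show "module.subspace scale (U (d - i))" "U (d - i) \<noteq> {0}"
    using assms by (simp_all add: decomposition_def)
next
  fix v
  define rev where "rev u = (\<lambda>i\<in>{..d}. u (d - i))" for u :: "nat \<Rightarrow> 'b"
  have sum_rev: "(\<Sum>i\<le>d. rev u i) = (\<Sum>i\<le>d. u i)" for u
    unfolding rev_def
    by (rule sum.reindex_bij_witness[of _ "\<lambda>i. d - i" "\<lambda>i. d - i"]) auto
  have rev_rev: "rev (rev u) = u" if "u \<in> extensional {..d}" for u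
    using that by (auto simp: rev_def extensional_def fun_eq_iff)
  have in1: "rev u \<in> (\<Pi>\<^sub>E i\<in>{..d}. U (d - i))" if "u \<in> (\<Pi>\<^sub>E i\<in>{..d}. U i)" for u
    using that by (auto simp: rev_def PiE_def)
  have in2: "rev u \<in> (\<Pi>\<^sub>E i\<in>{..d}. U i)" if "u \<in> (\<Pi>\<^sub>E i\<in>{..d}. U (d - i))" for u
  proof -
    have "u (d - i) \<in> U i" if "i \<le> d" for i
      using PiE_mem[OF \<open>u \<in> _\<close>, of "d - i"] that by simp
    then show ?thesis by (auto simp: rev_def)
  qed
  obtain u where u: "u \<in> (\<Pi>\<^sub>E i\<in>{..d}. U i)" "v = (\<Sum>i\<le>d. u i)"
    and uniq: "\<And>w. w \<in> (\<Pi>\<^sub>E i\<in>{..d}. U i) \<Longrightarrow> v = (\<Sum>i\<le>d. w i) \<Longrightarrow> w = u"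
    using assms unfolding decomposition_def by (metis (no_types, lifting))
  show "\<exists>!u. u \<in> (\<Pi>\<^sub>E i\<in>{..d}. U (d - i)) \<and> v = (\<Sum>i\<le>d. u i)"
  proof (rule ex1I[of _ "rev u"])
    show "rev u \<in> (\<Pi>\<^sub>E i\<in>{..d}. U (d - i)) \<and> v = (\<Sum>i\<le>d. rev u i)"
      using u in1 sum_rev by simp
    fix w assume w: "w \<in> (\<Pi>\<^sub>E i\<in>{..d}. U (d - i)) \<and> v = (\<Sum>i\<le>d. w i)"
    then have "rev w = u"
      using uniq[of "rev w"] in2 sum_rev by simp
    then show "w = rev u"
      using rev_rev[of w] w by (auto simp: PiE_def)
  qed
qed

theorem theorem1p6:
  fixes q :: "'k::alg_closed_field"
    and scale :: "'k \<Rightarrow> 'v::ab_group_add \<Rightarrow> 'v"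
    and Basis :: "'v set"
    and d :: nat
    and U :: "nat \<Rightarrow> 'v set"
    and KV R L :: "'v \<Rightarrow> 'v"
  assumes q_nonzero: "q \<noteq> 0"
    and q_not_root_of_unity: "\<forall>n::nat. n > 0 \<longrightarrow> q ^ n \<noteq> 1"
    and V_findim: "finite_dimensional_vector_space scale Basis"
    and V_dim_pos: "vector_space.dim scale (UNIV :: 'v set) > 0"
    and U_decomp: "decomposition scale d U"
    and KV_linear: "Vector_Spaces.linear scale scale KV"
    and KV_eigen: "\<forall>i\<le>d. \<forall>u\<in>U i. KV u = scale (q powi (2 * int i - int d)) u"
    and R_linear: "Vector_Spaces.linear scale scale R"
    and L_linear: "Vector_Spaces.linear scale scale L"
    and a: "\<forall>i<d. R ` U i \<subseteq> U (i + 1)" "R ` U d = {0}"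
    and b: "\<forall>i. 1 \<le> i \<and> i \<le> d \<longrightarrow> L ` U i \<subseteq> U (i - 1)" "L ` U 0 = {0}"
    and c: "\<forall>i. 2 * i \<le> d \<longrightarrow> bij_betw (R ^^ (d - 2 * i)) (U i) (U (d - i))"
    and d: "\<forall>i. 2 * i \<le> d \<longrightarrow> bij_betw (L ^^ (d - 2 * i)) (U (d - i)) (U i)"
    and e: "\<forall>v. R (R (R (L v))) - scale (qint q 3) (R (R (L (R v))))
              + scale (qint q 3) (R (L (R (R v)))) - L (R (R (R v))) = 0"
    and f: "\<forall>v. L (L (L (R v))) - scale (qint q 3) (L (L (R (L v))))
              + scale (qint q 3) (L (R (L (L v)))) - R (L (L (L v))) = 0"
  shows "\<exists>!act. uq_module_structure q scale act
            \<and> (\<forall>v. R v - act (uq_gen q (E Neg N1)) v = 0)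
            \<and> (\<forall>v. L v - act (uq_gen q (E Neg N0)) v = 0)
            \<and> (\<forall>v. KV v - act (uq_gen q (K N0)) v = 0)
            \<and> (\<forall>v. inv_into UNIV KV v - act (uq_gen q (K N1)) v = 0)"
proof -
  interpret finite_dimensional_vector_space scale Basis by (rule V_findim)
  interpret up: lefschetz scale q d U R
  proof unfold_locales
    show "R u \<in> U (Suc i)" if "i < d" "u \<in> U i" for i u
      using a(1) that by auto
    show "R u = 0" if "u \<in> U d" for u
      using a(2) that by blast
  qed (use q_nonzero q_not_root_of_unity U_decomp R_linear c
      in \<open>auto simp: Vector_Spaces.linear_iff\<close>)
  interpret down: lefschetz scale q d "\<lambda>i. U (d - i)" L
  proof unfold_locales
    show "L u \<in> U (d - Suc i)" if "i < d" "u \<in> U (d - i)" for i u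
    proof -
      have "L ` U (d - i) \<subseteq> U (d - i - 1)" using b(1)[rule_format, of "d - i"] that by simp
      then show ?thesis using that by auto
    qed
    show "L u = 0" if "u \<in> U (d - d)" for u
      using b(2) that by auto
    show "bij_betw (L ^^ (d - 2 * i)) (U (d - i)) (U (d - (d - i)))" if "2 * i \<le> d" for i
      using d that by simp
  qed (use U_decomp L_linear decomposition_reverse[OF U_decomp]
      in \<open>auto simp: Vector_Spaces.linear_iff\<close>)
  interpret KV: Vector_Spaces.linear scale scale KV by (rule KV_linear)

  \<comment> \<open>The inverse of \<open>K\<close>, defined by its eigenvalues.\<close>
  define KI where "KI v = (\<Sum>i\<le>d. scale (q powi (int d - 2 * int i)) (up.pr i v))" for v
  have KI_linear: "Vector_Spaces.linear scale scale KI"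
    unfolding KI_def Vector_Spaces.linear_iff
    using up.linear_pr vector_space_axioms
    by (auto simp: Vector_Spaces.linear_iff sum.distrib scale_sum_right scale_right_distrib
        mult.commute)
  have KI_eigen: "KI u = scale (q powi (int d - 2 * int i)) u" if "i \<le> d" "u \<in> U i" for i u
  proof -
    have "KI u = (\<Sum>j\<le>d. if j = i then scale (q powi (int d - 2 * int i)) u else 0)"
      unfolding KI_def using that by (intro sum.cong) (auto simp: up.pr_homogeneous)
    then show ?thesis using that by simp
  qed
  define \<kappa> \<kappa>' r l where "\<kappa> = Add_End KV" and "\<kappa>' = Add_End KI"
    and "r = Add_End R" and "l = Add_End L"
  have app: "app \<kappa> = KV" "app \<kappa>' = KI" "app r = R" "app l = L"
    by (simp_all add: \<kappa>_def \<kappa>'_def r_def l_def app_Add_End_linear KV_linear KI_linear R_linear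
        L_linear)
  obtain e1 where e1: "quantum_sl2 (homothety scale) q e1 r \<kappa>' \<kappa> (2 * int d)"
    using up.ex_quantum_sl2[of \<kappa> \<kappa>'] KV_eigen KI_eigen KV_linear KI_linear
    unfolding app r_def by blast
  have "\<exists>e. quantum_sl2 (homothety scale) q e (Add_End L) \<kappa> \<kappa>' (2 * int d)"
  proof (rule down.ex_quantum_sl2)
    fix i u assume iu: "i \<le> d" "u \<in> U (d - i)"
    have "int d - 2 * int (d - i) = 2 * int i - int d" "2 * int (d - i) - int d = int d - 2 * int i"
      using iu(1) by simp_all
    then show "app \<kappa>' u = scale (q powi (2 * int i - int d)) u"
      "app \<kappa> u = scale (q powi (int d - 2 * int i)) u"
      using KI_eigen[of "d - i" u] KV_eigen iu unfolding app by (metis diff_le_self)+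
  qed (simp_all add: app KI_linear KV_linear)
  then obtain e0 where e0: "quantum_sl2 (homothety scale) q e0 l \<kappa> \<kappa>' (2 * int d)"
    unfolding l_def by blast
  interpret Q: quantum_affine_sl2_pair "homothety scale" q e0 l \<kappa> \<kappa>' e1 r "2 * int d"
  proof (rule quantum_affine_sl2_pair.intro[OF e0 e1], unfold_locales)
    show "serre (homothety scale (qint q 3)) r l = 0"
      by (rule add_end_eqI) (use e in \<open>simp add: serre_def app eval_nat_numeral\<close>)
    show "serre (homothety scale (qint q 3)) l r = 0"
      by (rule add_end_eqI) (use f in \<open>simp add: serre_def app eval_nat_numeral\<close>)
  qed
  have "KI (KV v) = v" "KV (KI v) = v" for v
    using Q.A0.k_inverse by (metis app(1,2) app_simps(2,6))+
  then have inv_KV: "inv_into UNIV KV = KI"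
    by (intro inv_unique_comp) (simp_all add: fun_eq_iff)

  have ev: "free_algebra_evaluation (homothety scale) Q.gen"
    by unfold_locales (rule Q.gen_central)
  show ?thesis
  proof (rule ex_ex1I)
    have "\<exists>act. uq_module_structure q scale act \<and> (\<forall>x v. act (uq_gen q x) v = app (Q.gen x) v)"
      using ex_uq_module_of_evaluation[OF ev] uq_relations_iff[OF ev] Q.gen_uq_relations by blast
    then obtain act where "uq_module_structure q scale act"
      "\<And>x v. act (uq_gen q x) v = app (Q.gen x) v" by blast
    then show "\<exists>act. uq_module_structure q scale act
            \<and> (\<forall>v. R v - act (uq_gen q (E Neg N1)) v = 0)
            \<and> (\<forall>v. L v - act (uq_gen q (E Neg N0)) v = 0)
            \<and> (\<forall>v. KV v - act (uq_gen q (K N0)) v = 0)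
            \<and> (\<forall>v. inv_into UNIV KV v - act (uq_gen q (K N1)) v = 0)"
      by (intro exI[of _ act]) (simp add: app inv_KV)
  next
    have gens: "act (uq_gen q x) = app (Q.gen x)"
      if act: "uq_module_structure q scale act"
        and "\<forall>v. R v - act (uq_gen q (E Neg N1)) v = 0"
        "\<forall>v. L v - act (uq_gen q (E Neg N0)) v = 0"
        "\<forall>v. KV v - act (uq_gen q (K N0)) v = 0"
        "\<forall>v. inv_into UNIV KV v - act (uq_gen q (K N1)) v = 0" for act x
    proof -
      define \<phi> where "\<phi> = (\<lambda>x. Add_End (act (uq_gen q x)))"
      note ev_act = evaluation_of_uq_module[OF act, folded \<phi>_def]
      have rel: "uq_relations (homothety scale) q \<phi>"
        using uq_relations_iff[OF ev_act(1), of q] ev_act(4) by blast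
      have "act (uq_gen q (E Neg N1)) = R" "act (uq_gen q (E Neg N0)) = L"
        "act (uq_gen q (K N0)) = KV" "act (uq_gen q (K N1)) = KI"
        using that(2-) by (auto simp: inv_KV)
      then have "\<phi> (E Neg N0) = l" "\<phi> (E Neg N1) = r" "\<phi> (K N0) = \<kappa>" "\<phi> (K N1) = \<kappa>'"
        by (simp_all add: \<phi>_def r_def l_def \<kappa>_def \<kappa>'_def)
      then have "\<phi> x = Q.gen x"
        using free_algebra_evaluation.\<phi>_central[OF ev_act(1)] rel by (intro Q.gen_unique)
      then show ?thesis using ev_act(2)[of x] by (simp add: \<phi>_def)
    qed
    show "act = act'"
      if "uq_module_structure q scale act
            \<and> (\<forall>v. R v - act (uq_gen q (E Neg N1)) v = 0)
            \<and> (\<forall>v. L v - act (uq_gen q (E Neg N0)) v = 0)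
            \<and> (\<forall>v. KV v - act (uq_gen q (K N0)) v = 0)
            \<and> (\<forall>v. inv_into UNIV KV v - act (uq_gen q (K N1)) v = 0)"
        and "uq_module_structure q scale act'
            \<and> (\<forall>v. R v - act' (uq_gen q (E Neg N1)) v = 0)
            \<and> (\<forall>v. L v - act' (uq_gen q (E Neg N0)) v = 0)
            \<and> (\<forall>v. KV v - act' (uq_gen q (K N0)) v = 0)
            \<and> (\<forall>v. inv_into UNIV KV v - act' (uq_gen q (K N1)) v = 0)" for act act'
    proof (rule uq_module_ext)
      show "uq_module_structure q scale act" "uq_module_structure q scale act'"
        using that by blast+
      show "vector_space scale" by (rule vector_space_axioms)
      have "act (uq_gen q x) = app (Q.gen x)" "act' (uq_gen q x) = app (Q.gen x)" for x
        by (rule gens; use that in blast)+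
      then show "act (uq_gen q x) = act' (uq_gen q x)" for x
        by simp
    qed
  qed
qed

end
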